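(* Let $\nu$ be a probability measure on $(\mathcal E,\mathcal B(\mathcal E))$ and let $(\tau,Z)$ be an independent-cycles nominal impulse policy such that, for each $k\in\mathbb N$, $\sigma_k=\sigma$ and $Q_k(\cdot)=Q(\cdot)$ for some fixed random time $\sigma$ and distribution $Q$ on $\mathcal E$, respectively, where $Q_k$ denotes the distribution $Q_{(Y_k(\omega),Z_k(\omega))}$, which does not depend on $\omega$ on $\{\tau_k<\infty\}$. Let $(\check\Omega,\check{\mathcal F},\mathbb P_\nu^{(\tau,Z)})$, with $\mathbb P_\nu^{(\tau,Z)}=\int_{\mathcal E}\mathbb P_x^{(\tau,Z)}\,\nu(dx)$, and $X$ be the corresponding probability space and coordinate process; set $\tau_0=0$. Then the cycles $\{X(t):\tau_k\le t<\tau_{k+1}\}$ for $k\in\mathbb N_0=\{0,1,2,\dots\}$ are independent (that is, they are independent stochastic processes under $\mathbb P_\nu^{(\tau,Z)}$), and the cycles for $k\in\mathbb N=\{1,2,\dots\}$ are identically distributed.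
   Context: Setting. $\mathcal E$ is a complete separable metric space, $\Omega=D_{\mathcal E}[0,\infty)$ is the space of càdlàg functions, $X(t,\omega)=\omega(t)$ is the coordinate process, $\mathcal F=\sigma(X(t):t\ge0)$, $\mathcal F_t=\sigma(X(s):0\le s\le t)$, $\mathcal F_{t-}=\sigma(X(s):0\le s<t)$ for $t>0$ and $\mathcal F_{0-}=\{\emptyset,\Omega\}$. $\{\mathbb P_x:x\in\mathcal E\}$ is a family of probability measures on $(\Omega,\mathcal F)$ such that $(\Omega,\mathcal F,X,\{\mathcal F_t\},\{\mathbb P_x\})$ is a Markov family: (1) for each $F\in\mathcal F$, $x\mapsto\mathbb P_x(F)$ is universally measurable; (2) $\mathbb P_x(X(0)=x)=1$; (3) $\mathbb P_x(X(s+t)\in B\mid\mathcal F_s)=\mathbb P_x(X(s+t)\in B\mid X(s))$ $\mathbb P_x$-a.s.; (4) $\mathbb P_x(X(s+t)\in B\mid X(s)=y)=\mathbb P_y(X(t)\in B)$ for $\mathbb P_xX(s)^{-1}$-a.e. $y$; for all $x\in\mathcal E$, $s,t\ge0$, $B\in\mathcal B(\mathcal E)$. Each $\mathbb P_x$ has its support in $C_{\mathcal E}[0,\infty)$. Augmented space. $\check\Omega=\mathcal E\times\Omega$, $\check{\mathcal F}=\mathcal B(\mathcal E)\otimes\mathcal F$; elements are $\check\omega=(\check\omega(0-),\check\omega(\cdot))$; $X(0-,\check\omega)=\check\omega(0-)$, $X(t,\check\omega)=\check\omega(t)$ for $t\ge0$; $\check{\mathcal F}_t=\mathcal B(\mathcal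 E)\otimes\mathcal F_t$, $\check{\mathcal F}_{t-}=\mathcal B(\mathcal E)\otimes\mathcal F_{t-}$ for $t\ge0$. $\check{\mathbb P}_x$ is the extension of $\mathbb P_x$ to $(\check\Omega,\check{\mathcal F})$ putting full mass on $\{\check\omega(0-)=x\}$. Impulse mechanism. $(\mathcal Z,\mathfrak Z)$ is a measurable space and $\{Q_{(y,z)}:(y,z)\in\mathcal E\times\mathcal Z\}$ is a family of probability measures on $\mathcal E$ such that $(y,z)\mapsto Q_{(y,z)}(\Gamma)$ is $\mathcal B(\mathcal E)\otimes\mathfrak Z$-measurable for each $\Gamma\in\mathcal B(\mathcal E)$. For a stopping time $\eta$, $\mathcal F_{\eta-}=\sigma(\{A\cap\{\eta>t\}:A\in\mathcal F_{t-},\,t\ge0\})$ and $\check{\mathcal F}_{\eta-}=\mathcal B(\mathcal E)\otimes\mathcal F_{\eta-}$. Nominal impulse policy. A sequence $(\tau,Z)=\{(\tau_k,Z_k):k\in\mathbb N\}$ defined on $(\check\Omega,\check{\mathcal F})$ with: $\tau_1$ an $\{\check{\mathcal F}_{t-}\}$-stopping time and, for $k\ge2$, $\tau_k$ an $\{\mathcal F_{t-}\}$-stopping time (evaluated on $\check\Omega$ through the projection $\check\omega\mapsto\check\omega(\cdot)$, as is $Z_k$ for $k\ge 2$); $\tau_{k+1}>\tau_k$ on $\{\tau_k<\infty\}$ for each $k\in\mathbb N$; $\lim_{k\to\infty}\tau_k=\infty$; and $Z_k$ a $\mathcal Z$-valued, $\mathcal F_{\tau_k-}/\mathfrak Z$-measurable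 random variable ($\check{\mathcal F}_{\tau_1-}/\mathfrak Z$-measurable for $k=1$). Set $\tau_0=0$ and $Y_k=X(\tau_k-)$ on $\{\tau_k<\infty\}$. Independent-cycles nominal impulse policy. A nominal impulse policy such that for each $k\in\mathbb N$: (a) there exists a random time $\sigma_k$ such that $\tau_k=\tau_{k-1}+\sigma_k\circ\theta_{\tau_{k-1}}$ on the set $\{\tau_{k-1}<\infty\}$, where $\theta_{\tau_0}$ is the identity mapping on $\check\Omega$ and, for $k\ge2$, $\theta_{\tau_{k-1}}(\check\omega)=\check\omega(\tau_{k-1}(\check\omega)+\cdot)\in\Omega$; and (b) on the event $\{\tau_k<\infty\}$, the intervention $(\tau_k,Z_k)$ is such that $Q_{(Y_k(\omega),Z_k(\omega))}$ does not depend on $\omega$. The measures $\mathbb P_x^{(\tau,Z)}$. Fix $\bar e\in\mathcal E$, $\bar z\in\mathcal Z$. Let $\Omega_0=\check\Omega$, $\Omega_k=\Omega$ for $k\ge1$, with $\sigma$-algebras $\mathscr F_0=\check{\mathcal F}$, $\mathscr F_k=\mathcal F$ and coordinate processes $X_k$; $\widetilde\Omega=\prod_{k\ge0}\Omega_k$, $\widetilde{\mathcal G}=\bigotimes_{k\ge0}\mathscr F_k$; $\mathbf e_k=(\omega_0,\dots,\omega_k)$. Put $\widetilde\tau_0=0$, $\bar\omega_0=\omega_0$ and recursively, for $k\ge0$, $\widetilde\tau_{k+1}(\mathbf e_k)=\tau_{k+1}(\bar\omega_k)$, where for $k\ge1$ $\bar\omega_k\in\check\Omega$ is the pasted path with $\bar\omega_k(0-)=\omega_0(0-)$,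 $\bar\omega_k(t)=\omega_i(t-\widetilde\tau_i)$ for $\widetilde\tau_i\le t<\widetilde\tau_{i+1}$, $i\le k-1$, and $\bar\omega_k(t)=\omega_k(t-\widetilde\tau_k)$ for $t\ge\widetilde\tau_k$. On $\{\widetilde\tau_{k+1}<\infty\}$ let $\widetilde Z_{k+1}(\mathbf e_k)=Z_{k+1}(\bar\omega_k)$ and $\widetilde Y_{k+1}(\mathbf e_k)=\bar\omega_k(\widetilde\tau_{k+1}-)$; on $\{\widetilde\tau_{k+1}=\infty\}$ let them be $\bar z$ and $\bar e$. Let $\widetilde Q_{k+1}(\mathbf e_k,\cdot)=Q_{(\widetilde Y_{k+1},\widetilde Z_{k+1})}$ if $\widetilde\tau_{k+1}(\mathbf e_k)<\infty$ and $\delta_{\bar e}$ otherwise, and $P_{k+1}(\mathbf e_k,\cdot)=\int_{\mathcal E}\mathbb P_v(\cdot)\,\widetilde Q_{k+1}(\mathbf e_k,dv)$. $\widetilde{\mathbb P}_x$ is the probability measure on $(\widetilde\Omega,\widetilde{\mathcal G})$ with initial law $\check{\mathbb P}_x$ on $\Omega_0$ and successive transition kernels $P_1,P_2,\dots$ (Ionescu Tulcea). Put $\widetilde X(0-)=\omega_0(0-)$ and $\widetilde X(t)=X_k(t-\widetilde\tau_k)$ for $\widetilde\tau_k\le t<\widetilde\tau_{k+1}$, $k\ge0$. Then $\mathbb P_x^{(\tau,Z)}=\widetilde{\mathbb P}_x\widetilde X^{-1}$ is the law of $\widetilde X$ on $(\check\Omega,\check{\mathcal F})$; $x\mapsto\mathbb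 P_x^{(\tau,Z)}(F)$ is universally measurable for each $F\in\check{\mathcal F}$.
   Formalization: Proved as stated if all τ_k are a.s. finite (false otherwise); in general cycles 0..n are independent given τ_n<∞, and the law of cycle k given τ_k<∞ is the same for all k≥1. Cycles are re-timed to start at 0; τ_{k+1}=∞ is assumed where τ_k=∞. *)

theory Defs
  imports "HOL-Probability.Probability"
begin

section \<open>Path space\<close>

text \<open>Paths are functions on \<open>[0,\<infinity>)\<close>, encoded as functions on the reals that are
  \<open>undefined\<close> at negative times.\<close>

type_synonym 'e path = "real \<Rightarrow> 'e"

definition cadlag :: "('e::polish_space) path set" where
  "cadlag = {\<omega> \<in> extensional {0..}. \<forall>t\<ge>0.
      (\<omega> \<longlongrightarrow> \<omega> t) (at_right t) \<and> (0 < t \<longrightarrow> (\<exists>l. (\<omega> \<longlongrightarrow> l) (at_left t)))}"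

text \<open>\<open>path_algebra I\<close> is \<open>\<sigma>(X(t) : t \<in> I)\<close>, for \<open>I \<subseteq> [0,\<infinity>)\<close>.\<close>

definition path_algebra :: "real set \<Rightarrow> ('e::polish_space) path measure" where
  "path_algebra I = sigma cadlag {{\<omega> \<in> cadlag. \<omega> t \<in> B} | t B. t \<in> I \<and> B \<in> sets borel}"

abbreviation path_F :: "('e::polish_space) path measure" where
  "path_F \<equiv> path_algebra {0..}"

definition path_upto :: "real \<Rightarrow> ('e::polish_space) path measure" where
  "path_upto t = path_algebra {0..t}"

text \<open>\<open>path_before t\<close> is \<open>\<F>\<^sub>t\<^sub>-\<close>; it is trivial for \<open>t = 0\<close>. The index runs through \<open>[0,\<infinity>]\<close> only
  because \<^const>\<open>stopping_time\<close> wants indices and random times of the same type; the condition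
  it imposes at \<open>\<infinity>\<close> is void.\<close>

definition path_before :: "ennreal \<Rightarrow> ('e::polish_space) path measure" where
  "path_before t = path_algebra {s. 0 \<le> s \<and> ennreal s < t}"

definition path_before_time :: "('e path \<Rightarrow> ennreal) \<Rightarrow> ('e::polish_space) path measure" where
  "path_before_time T = sigma cadlag
     {A \<inter> {\<omega> \<in> cadlag. ennreal t < T \<omega>} | A t. 0 \<le> t \<and> A \<in> sets (path_before (ennreal t))}"

section \<open>Markov families\<close>

definition universally_measurable :: "('e::topological_space \<Rightarrow> real) \<Rightarrow> bool" where
  "universally_measurable f \<longleftrightarrow>
     (\<forall>\<mu> \<in> space (prob_algebra borel). f \<in> borel_measurable (completion \<mu>))"

text \<open>In the last clause \<open>g\<close> is a version of \<open>y \<mapsto> P\<^sub>x(X(s+t) \<in> B | X(s) = y)\<close>.\<close>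

definition markov_family :: "('e::polish_space \<Rightarrow> 'e path measure) \<Rightarrow> bool" where
  "markov_family P \<longleftrightarrow>
     (\<forall>x. P x \<in> space (prob_algebra path_F)) \<and>
     (\<forall>F \<in> sets path_F. universally_measurable (\<lambda>x. measure (P x) F)) \<and>
     (\<forall>x. measure (P x) {\<omega> \<in> cadlag. \<omega> 0 = x} = 1) \<and>
     (\<forall>x s t B. 0 \<le> s \<longrightarrow> 0 \<le> t \<longrightarrow> B \<in> sets borel \<longrightarrow>
        (AE \<omega> in P x.
           real_cond_exp (P x) (path_upto s) (indicator {\<omega> \<in> cadlag. \<omega> (s + t) \<in> B}) \<omega> =
           real_cond_exp (P x) (vimage_algebra cadlag (\<lambda>\<omega>. \<omega> s) borel)
             (indicator {\<omega> \<in> cadlag. \<omega> (s + t) \<in> B}) \<omega>)) \<and>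
     (\<forall>x s t B. 0 \<le> s \<longrightarrow> 0 \<le> t \<longrightarrow> B \<in> sets borel \<longrightarrow>
        (\<exists>g \<in> borel_measurable borel.
           (AE \<omega> in P x.
              real_cond_exp (P x) (vimage_algebra cadlag (\<lambda>\<omega>. \<omega> s) borel)
                (indicator {\<omega> \<in> cadlag. \<omega> (s + t) \<in> B}) \<omega> = g (\<omega> s)) \<and>
           (AE y in distr (P x) borel (\<lambda>\<omega>. \<omega> s).
              g y = measure (P y) {\<omega> \<in> cadlag. \<omega> t \<in> B})))"

section \<open>Augmented paths\<close>

text \<open>The first component of an augmented path is its value at time \<open>0-\<close>.\<close>

type_synonym 'e apath = "'e \<times> 'e path"

definition aug :: "('e::polish_space) apath measure" where
  "aug = borel \<Otimes>\<^sub>M path_F"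

definition aug_before :: "ennreal \<Rightarrow> ('e::polish_space) apath measure" where
  "aug_before t = borel \<Otimes>\<^sub>M path_before t"

text \<open>The \<sigma>-algebra \<open>\<B>(E) \<otimes> \<F>\<^sub>\<eta>\<^sub>-\<close>, written through its generators so that it makes sense for a
  time \<open>\<eta>\<close> that depends on the value at \<open>0-\<close>, too.\<close>

definition aug_before_time :: "('e apath \<Rightarrow> ennreal) \<Rightarrow> ('e::polish_space) apath measure" where
  "aug_before_time T = sigma (space aug)
     ({B \<times> cadlag | B. B \<in> sets borel} \<union>
      {(UNIV \<times> A) \<inter> {\<omega> \<in> space aug. ennreal t < T \<omega>} | A t.
         0 \<le> t \<and> A \<in> sets (path_before (ennreal t))})"

definition aug_law :: "('e::polish_space \<Rightarrow> 'e path measure) \<Rightarrow> 'e \<Rightarrow> 'e apath measure" where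
  "aug_law P x = distr (P x) aug (\<lambda>\<omega>. (x, \<omega>))"

definition left_limit :: "('e::polish_space) apath \<Rightarrow> real \<Rightarrow> 'e" where
  "left_limit \<omega> t = (if t = 0 then fst \<omega> else Lim (at_left t) (snd \<omega>))"

definition shift :: "ennreal \<Rightarrow> 'e apath \<Rightarrow> 'e path" where
  "shift T \<omega> = (\<lambda>t\<in>{0..}. snd \<omega> (enn2real T + t))"

section \<open>Nominal impulse policies\<close>

text \<open>The times \<open>\<tau>\<^sub>k\<close> for \<open>k \<ge> 1\<close> are those of the policy, and \<open>\<tau>\<^sub>0 = 0\<close>; \<open>Z 0\<close> is irrelevant. The times
  are nondecreasing, so that no impulse follows an impulse time that is infinite.\<close>

definition nominal_policy ::
  "'z measure \<Rightarrow> (nat \<Rightarrow> 'e apath \<Rightarrow> ennreal) \<Rightarrow> (nat \<Rightarrow> ('e::polish_space) apath \<Rightarrow> 'z) \<Rightarrow> bool"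
where
  "nominal_policy ZZ \<tau> Z \<longleftrightarrow>
     (\<forall>\<omega> \<in> space aug. \<tau> 0 \<omega> = 0) \<and>
     stopping_time aug_before (\<tau> 1) \<and>
     Z 1 \<in> measurable (aug_before_time (\<tau> 1)) ZZ \<and>
     (\<forall>k\<ge>2. \<exists>T \<zeta>. stopping_time path_before T \<and> \<zeta> \<in> measurable (path_before_time T) ZZ \<and>
        (\<forall>\<omega> \<in> space aug. \<tau> k \<omega> = T (snd \<omega>) \<and> Z k \<omega> = \<zeta> (snd \<omega>))) \<and>
     (\<forall>k\<ge>1. \<forall>\<omega> \<in> space aug. \<tau> k \<omega> \<le> \<tau> (Suc k) \<omega> \<and> (\<tau> k \<omega> < \<infinity> \<longrightarrow> \<tau> k \<omega> < \<tau> (Suc k) \<omega>)) \<and>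
     (\<forall>\<omega> \<in> space aug. (\<lambda>k. \<tau> k \<omega>) \<longlonglongrightarrow> \<infinity>)"

definition pre_impulse ::
  "(nat \<Rightarrow> 'e apath \<Rightarrow> ennreal) \<Rightarrow> nat \<Rightarrow> ('e::polish_space) apath \<Rightarrow> 'e" where
  "pre_impulse \<tau> k \<omega> = left_limit \<omega> (enn2real (\<tau> k \<omega>))"

text \<open>\<open>\<sigma>\<^sub>1\<close> lives on augmented paths, and \<open>\<sigma>\<^sub>k\<close> for \<open>k \<ge> 2\<close> on paths; \<open>Qs k\<close> is the common value of
  \<open>Q\<^bsub>(Y\<^sub>k,Z\<^sub>k)\<^esub>\<close> on \<open>{\<tau>\<^sub>k < \<infinity>}\<close>.\<close>

definition independent_cycles_policy ::
  "'z measure \<Rightarrow> ('e \<times> 'z \<Rightarrow> 'e measure) \<Rightarrow>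
   (nat \<Rightarrow> 'e apath \<Rightarrow> ennreal) \<Rightarrow> (nat \<Rightarrow> ('e::polish_space) apath \<Rightarrow> 'z) \<Rightarrow>
   ('e apath \<Rightarrow> ennreal) \<Rightarrow> (nat \<Rightarrow> 'e path \<Rightarrow> ennreal) \<Rightarrow> (nat \<Rightarrow> 'e measure) \<Rightarrow> bool"
where
  "independent_cycles_policy ZZ Q \<tau> Z \<sigma>1 \<sigma> Qs \<longleftrightarrow>
     nominal_policy ZZ \<tau> Z \<and>
     \<sigma>1 \<in> borel_measurable aug \<and> (\<forall>k\<ge>2. \<sigma> k \<in> borel_measurable path_F) \<and>
     (\<forall>\<omega> \<in> space aug. \<tau> 1 \<omega> = \<tau> 0 \<omega> + \<sigma>1 \<omega>) \<and>
     (\<forall>k\<ge>2. \<forall>\<omega> \<in> space aug. \<tau> (k - 1) \<omega> < \<infinity> \<longrightarrow>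
        \<tau> k \<omega> = \<tau> (k - 1) \<omega> + \<sigma> k (shift (\<tau> (k - 1) \<omega>) \<omega>)) \<and>
     (\<forall>k\<ge>1. \<forall>\<omega> \<in> space aug. \<tau> k \<omega> < \<infinity> \<longrightarrow> Q (pre_impulse \<tau> k \<omega>, Z k \<omega>) = Qs k)"

section \<open>The controlled process\<close>

text \<open>\<open>\<Omega>\<^sub>0 \<times> \<Omega>\<^sub>1 \<times> \<dots>\<close> is re-bracketed as \<open>E\<close> times a countable power of the path space: the point
  \<open>(e, w)\<close> stands for \<open>\<omega>\<^sub>0 = (e, w 0)\<close> and \<open>\<omega>\<^sub>k = w k\<close>, \<open>k \<ge> 1\<close>. The functions of \<open>(\<omega>\<^sub>0,\<dots>,\<omega>\<^sub>k)\<close>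
  below use the coordinates \<open>0,\<dots>,k\<close> of \<open>w\<close> only.\<close>

type_synonym 'e seqs = "'e \<times> (nat \<Rightarrow> 'e path)"

definition seq_space :: "('e::polish_space) seqs measure" where
  "seq_space = borel \<Otimes>\<^sub>M (\<Pi>\<^sub>M k\<in>UNIV. path_F)"

definition hist_space :: "nat \<Rightarrow> ('e::polish_space) seqs measure" where
  "hist_space k = borel \<Otimes>\<^sub>M (\<Pi>\<^sub>M i\<in>{..k}. path_F)"

definition hist :: "nat \<Rightarrow> 'e seqs \<Rightarrow> 'e seqs" where
  "hist k w = (fst w, restrict (snd w) {..k})"

definition paste :: "'e apath \<Rightarrow> ennreal \<Rightarrow> 'e path \<Rightarrow> 'e apath" where
  "paste \<omega> T \<omega>' =
     (fst \<omega>, \<lambda>t\<in>{0..}. if ennreal t < T then snd \<omega> t else \<omega>' (t - enn2real T))"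

text \<open>\<open>pasted \<tau> k\<close> follows \<open>\<omega>\<^sub>i(\<sqdot> - \<tau>\<^sub>i)\<close> on \<open>[\<tau>\<^sub>i, \<tau>\<^sub>i\<^sub>+\<^sub>1)\<close> for \<open>i < k\<close>, and \<open>\<omega>\<^sub>k(\<sqdot> - \<tau>\<^sub>k)\<close> from
  time \<open>\<tau>\<^sub>k\<close> on, where \<open>\<tau>\<^sub>i\<close> is \<open>ctrl_time \<tau> i\<close>.\<close>

primrec pasted :: "(nat \<Rightarrow> 'e apath \<Rightarrow> ennreal) \<Rightarrow> nat \<Rightarrow> 'e seqs \<Rightarrow> 'e apath" where
  "pasted \<tau> 0 w = (fst w, snd w 0)"
| "pasted \<tau> (Suc k) w = paste (pasted \<tau> k w) (\<tau> (Suc k) (pasted \<tau> k w)) (snd w (Suc k))"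

definition ctrl_time :: "(nat \<Rightarrow> 'e apath \<Rightarrow> ennreal) \<Rightarrow> nat \<Rightarrow> 'e seqs \<Rightarrow> ennreal" where
  "ctrl_time \<tau> k w = (case k of 0 \<Rightarrow> 0 | Suc j \<Rightarrow> \<tau> (Suc j) (pasted \<tau> j w))"

definition impulse_law ::
  "('e \<times> 'z \<Rightarrow> 'e measure) \<Rightarrow> 'e \<Rightarrow> (nat \<Rightarrow> 'e apath \<Rightarrow> ennreal) \<Rightarrow>
   (nat \<Rightarrow> ('e::polish_space) apath \<Rightarrow> 'z) \<Rightarrow> nat \<Rightarrow> 'e seqs \<Rightarrow> 'e measure" where
  "impulse_law Q ebar \<tau> Z k w =
     (if ctrl_time \<tau> (Suc k) w < \<infinity>
      then Q (pre_impulse \<tau> (Suc k) (pasted \<tau> k w), Z (Suc k) (pasted \<tau> k w))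
      else return borel ebar)"

text \<open>The kernel of the step from \<open>k\<close> to \<open>k + 1\<close>. The completion makes the universally measurable
  \<open>v \<mapsto> P\<^sub>v\<close> measurable.\<close>

definition step_kernel ::
  "('e \<Rightarrow> 'e path measure) \<Rightarrow> ('e \<times> 'z \<Rightarrow> 'e measure) \<Rightarrow> 'e \<Rightarrow> (nat \<Rightarrow> 'e apath \<Rightarrow> ennreal) \<Rightarrow>
   (nat \<Rightarrow> ('e::polish_space) apath \<Rightarrow> 'z) \<Rightarrow> nat \<Rightarrow> 'e seqs \<Rightarrow> 'e path measure" where
  "step_kernel P Q ebar \<tau> Z k w = completion (impulse_law Q ebar \<tau> Z k w) \<bind> P"

text \<open>The law on \<^const>\<open>seq_space\<close> with initial law \<open>M0\<close> and successive transition kernels \<open>K\<close>.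
  The Ionescu Tulcea locale of the library does not apply because it wants kernels that are
  measurable for the product \<sigma>-algebra, without completion.\<close>

definition has_kernels ::
  "('e::polish_space) apath measure \<Rightarrow> (nat \<Rightarrow> 'e seqs \<Rightarrow> 'e path measure) \<Rightarrow> 'e seqs measure \<Rightarrow> bool"
where
  "has_kernels M0 K M \<longleftrightarrow>
     M \<in> space (prob_algebra seq_space) \<and>
     distr M aug (\<lambda>w. (fst w, snd w 0)) = M0 \<and>
     (\<forall>k. \<forall>A \<in> sets (hist_space k). \<forall>F \<in> sets path_F.
        emeasure M {w \<in> space seq_space. hist k w \<in> A \<and> snd w (Suc k) \<in> F} =
        (\<integral>\<^sup>+w. indicator A (hist k w) * emeasure (K k (hist k w)) F \<partial>completion M))"

definition seq_law ::
  "('e \<Rightarrow> 'e path measure) \<Rightarrow> ('e \<times> 'z \<Rightarrow> 'e measure) \<Rightarrow> 'e \<Rightarrow> (nat \<Rightarrow> 'e apath \<Rightarrow> ennreal) \<Rightarrow>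
   (nat \<Rightarrow> ('e::polish_space) apath \<Rightarrow> 'z) \<Rightarrow> 'e \<Rightarrow> 'e seqs measure" where
  "seq_law P Q ebar \<tau> Z x =
     (THE M. has_kernels (aug_law P x) (step_kernel P Q ebar \<tau> Z) M)"

text \<open>Sample points for which the impulse times accumulate at a finite time are sent to a constant
  path.\<close>

definition ctrl_path :: "'e \<Rightarrow> (nat \<Rightarrow> 'e apath \<Rightarrow> ennreal) \<Rightarrow> 'e seqs \<Rightarrow> 'e apath" where
  "ctrl_path ebar \<tau> w =
     (fst w,
      if (\<lambda>k. ctrl_time \<tau> k w) \<longlonglongrightarrow> \<infinity>
      then (\<lambda>t\<in>{0..}.
              let k = (THE k. ctrl_time \<tau> k w \<le> ennreal t \<and> ennreal t < ctrl_time \<tau> (Suc k) w)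
              in snd w k (t - enn2real (ctrl_time \<tau> k w)))
      else (\<lambda>t\<in>{0..}. ebar))"

definition ctrl_law ::
  "('e \<Rightarrow> 'e path measure) \<Rightarrow> ('e \<times> 'z \<Rightarrow> 'e measure) \<Rightarrow> 'e \<Rightarrow> (nat \<Rightarrow> 'e apath \<Rightarrow> ennreal) \<Rightarrow>
   (nat \<Rightarrow> ('e::polish_space) apath \<Rightarrow> 'z) \<Rightarrow> 'e \<Rightarrow> 'e apath measure" where
  "ctrl_law P Q ebar \<tau> Z x = distr (seq_law P Q ebar \<tau> Z x) aug (ctrl_path ebar \<tau>)"

text \<open>The mixture of the laws \<^const>\<open>ctrl_law\<close>, which depend on \<open>x\<close> universally measurably.\<close>

definition ctrl_law_init ::
  "('e \<Rightarrow> 'e path measure) \<Rightarrow> ('e \<times> 'z \<Rightarrow> 'e measure) \<Rightarrow> 'e \<Rightarrow> (nat \<Rightarrow> 'e apath \<Rightarrow> ennreal) \<Rightarrow>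
   (nat \<Rightarrow> ('e::polish_space) apath \<Rightarrow> 'z) \<Rightarrow> 'e measure \<Rightarrow> 'e apath measure" where
  "ctrl_law_init P Q ebar \<tau> Z \<nu> = completion \<nu> \<bind> ctrl_law P Q ebar \<tau> Z"

section \<open>Cycles\<close>

text \<open>The process \<open>{X(t) : \<tau>\<^sub>k \<le> t < \<tau>\<^sub>k\<^sub>+\<^sub>1}\<close>, with time counted from \<open>\<tau>\<^sub>k\<close> and \<open>None\<close> as
  cemetery after the random lifetime. It is \<open>None\<close> throughout if \<open>\<tau>\<^sub>k = \<infinity>\<close>.\<close>

definition option_borel :: "('e::topological_space) option measure" where
  "option_borel = sigma UNIV (insert {None} {Some ` B | B. B \<in> sets borel})"

definition cycle_space :: "(real \<Rightarrow> ('e::topological_space) option) measure" where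
  "cycle_space = (\<Pi>\<^sub>M t\<in>{0..}. option_borel)"

definition path_cycle ::
  "(nat \<Rightarrow> 'e apath \<Rightarrow> ennreal) \<Rightarrow> nat \<Rightarrow> 'e apath \<Rightarrow> real \<Rightarrow> 'e option" where
  "path_cycle \<tau> k \<omega> = (\<lambda>t\<in>{0..}.
     if \<tau> k \<omega> + ennreal t < \<tau> (Suc k) \<omega> then Some (snd \<omega> (enn2real (\<tau> k \<omega>) + t)) else None)"

text \<open>The conditional law given that cycle \<open>k\<close> starts at all.\<close>

definition given_started ::
  "(nat \<Rightarrow> 'e apath \<Rightarrow> ennreal) \<Rightarrow> nat \<Rightarrow> 'e apath measure \<Rightarrow> 'e apath measure" where
  "given_started \<tau> k M = uniform_measure M {\<omega> \<in> space M. \<tau> k \<omega> < \<infinity>}"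

end

theory Submission
  imports Defs
begin

text \<open>Galmarini's test, applied to the pasted paths, turns the recursion for the impulse times of the policy
  into \<open>T\<^bsub>k+1\<^esub> = T\<^sub>k + \<sigma>(\<omega>\<^sub>k)\<close> for the controlled process, and shows that the times \<open>\<tau>\<^sub>k\<close> of the
  controlled path are the \<open>T\<^sub>k\<close>. So cycle \<open>k\<close> is a function of \<open>\<omega>\<^sub>k\<close> alone. The kernels take only two
  values, according to whether \<open>T\<^bsub>k+1\<^esub>\<close> is finite, so the law of the \<open>\<omega>\<^sub>k\<close> can be realized on a
  product space: \<open>\<omega>\<^sub>k\<close> equals an independent path \<open>u\<^sub>k\<close> as long as all earlier \<open>\<sigma>(u\<^sub>j)\<close> are finite.
  Strict monotonicity of the impulse times forces \<open>\<sigma> > 0\<close>, hence \<open>T\<^sub>k\<close> tends to infinity almost surely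
  and the impulse times do not accumulate. Independence and equality in law of the cycles can then be read off
  the product formula for \<open>P(\<tau>\<^sub>n < \<infinity>, C\<^sub>0 \<in> A\<^sub>0, \<dots>, C\<^sub>n \<in> A\<^sub>n)\<close>.\<close>

section \<open>Paths and stopping times\<close>

text \<open>Impulses may stop with positive probability, and then the cycles need not be independent
  without conditioning: \<open>\<tau> k = \<infinity>\<close> says that cycle \<open>k\<close> is
  empty, but also that an earlier cycle never ends. The factorization therefore lives on
  \<open>\<tau> n < \<infinity>\<close>, which asks for a finite lifetime of each cycle before
  \<open>n\<close> and nothing of cycle \<open>n\<close>. This is why identity in law compares each
  cycle conditioned on its own start. The unconditional claims are the case where these events have
  probability one. The other obstacle is that \<open>P\<close> is only universally measurable. The
  completion is confined to averages of \<open>P\<close> over a starting point. These averages are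
  fixed measures, and the choice between the two that occur is a measurable function of the history,
  so uniqueness for given kernels can be shown on ordinary product spaces. The strict past is
  essential to the pasting: a stopping time of that filtration does not look at the value at the
  time itself, which is what an impulse changes.\<close>

lemma space_path_algebra [simp]: "space (path_algebra I) = cadlag"
  by (simp add: path_algebra_def space_measure_of_conv)

lemma sets_path_algebra:
  "sets (path_algebra I) = sigma_sets cadlag {{\<omega> \<in> cadlag. \<omega> t \<in> B} | t B. t \<in> I \<and> B \<in> sets borel}"
  unfolding path_algebra_def by (rule sets_measure_of) auto

lemma sets_path_algebra_mono:
  assumes "I \<subseteq> J"
  shows "sets (path_algebra I) \<subseteq> sets (path_algebra J)"
  unfolding sets_path_algebra by (rule sigma_sets_mono') (use assms in blast)

lemma measurable_path_eval:
  assumes "t \<in> I"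
  shows "(\<lambda>\<omega>. \<omega> t) \<in> path_algebra I \<rightarrow>\<^sub>M borel"
proof (rule measurableI)
  fix B :: "'a set" assume "B \<in> sets borel"
  then have "{\<omega> \<in> cadlag. \<omega> t \<in> B} \<in> sets (path_algebra I)"
    unfolding sets_path_algebra using assms by (intro sigma_sets.Basic) blast
  then show "(\<lambda>\<omega>. \<omega> t) -` B \<inter> space (path_algebra I) \<in> sets (path_algebra I)"
    by (simp add: vimage_def Int_def conj_commute)
qed simp

lemma measurable_into_path:
  fixes f :: "'a \<Rightarrow> ('e::polish_space) path"
  assumes "\<And>x. x \<in> space M \<Longrightarrow> f x \<in> cadlag"
    and "\<And>t. t \<in> I \<Longrightarrow> (\<lambda>x. f x t) \<in> M \<rightarrow>\<^sub>M borel"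
  shows "f \<in> M \<rightarrow>\<^sub>M path_algebra I"
  unfolding path_algebra_def
proof (rule measurable_measure_of)
  show "f \<in> space M \<rightarrow> cadlag"
    using assms(1) by auto
  fix A :: "'e path set" assume "A \<in> {{\<omega> \<in> cadlag. \<omega> t \<in> B} | t B. t \<in> I \<and> B \<in> sets borel}"
  then obtain t B where A: "A = {\<omega> \<in> cadlag. \<omega> t \<in> B}" "t \<in> I" "B \<in> sets borel"
    by blast
  have "f -` A \<inter> space M = (\<lambda>x. f x t) -` B \<inter> space M"
    using assms(1) A by auto
  then show "f -` A \<inter> space M \<in> sets M"
    using measurable_sets[OF assms(2)[OF A(2)] A(3)] by simp
qed auto

text \<open>A generator looks at one coordinate in \<open>I\<close>, and failing to separate two
  given paths survives complements and countable unions. Both paths must lie in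
  \<open>cadlag\<close> because complements are taken there.\<close>

lemma path_algebra_sets_cong:
  assumes "A \<in> sets (path_algebra I)" "\<omega> \<in> cadlag" "\<omega>' \<in> cadlag" "\<And>t. t \<in> I \<Longrightarrow> \<omega> t = \<omega>' t"
  shows "\<omega> \<in> A \<longleftrightarrow> \<omega>' \<in> A"
  using assms(1) unfolding sets_path_algebra
  by (induction rule: sigma_sets.induct) (use assms(2-) in auto)

lemma aug_before_sets_cong:
  assumes "A \<in> sets (aug_before t)" "snd \<omega> \<in> cadlag" "snd \<omega>' \<in> cadlag" "fst \<omega> = fst \<omega>'"
    and "\<And>s. 0 \<le> s \<Longrightarrow> ennreal s < t \<Longrightarrow> snd \<omega> s = snd \<omega>' s"
  shows "\<omega> \<in> A \<longleftrightarrow> \<omega>' \<in> A"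
proof -
  have "A \<in> sigma_sets (UNIV \<times> cadlag) {a \<times> b | a b. a \<in> sets borel \<and> b \<in> sets (path_before t)}"
    using assms(1) by (simp add: aug_before_def sets_pair_measure path_before_def)
  then show ?thesis
  proof (induction rule: sigma_sets.induct)
    case (Basic c)
    then obtain a b where c: "c = a \<times> b" "b \<in> sets (path_before t)"
      by blast
    have "snd \<omega> \<in> b \<longleftrightarrow> snd \<omega>' \<in> b"
      by (rule path_algebra_sets_cong[OF c(2)[unfolded path_before_def]]) (use assms in auto)
    then show ?case
      using c assms(4) by (auto simp: mem_Times_iff)
  qed (use assms(2-4) in \<open>auto simp: mem_Times_iff\<close>)
qed

lemma space_aug: "space aug = UNIV \<times> cadlag"
  by (simp add: aug_def space_pair_measure)

text \<open>Galmarini's test.\<close>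

lemma stopping_time_path_before_cong:
  assumes T: "stopping_time path_before T" and \<omega>: "\<omega> \<in> cadlag" "\<omega>' \<in> cadlag"
    and agree: "\<And>t. 0 \<le> t \<Longrightarrow> ennreal t < T \<omega> \<Longrightarrow> \<omega> t = \<omega>' t"
  shows "T \<omega>' = T \<omega>"
proof -
  \<comment> \<open>The event that \<open>T\<close> is at most \<open>t\<close> belongs to the
    strict past of \<open>t\<close>, which cannot separate the paths as long as
    \<open>t \<le> T \<omega>\<close>. The choice \<open>t = T \<omega>\<close> gives one
    inequality, and then \<open>t = T \<omega>'\<close> gives the other.\<close>
  have *: "T \<omega> \<le> t \<longleftrightarrow> T \<omega>' \<le> t" if "t \<le> T \<omega>" for t
  proof -
    have "{\<omega> \<in> space (path_before t). T \<omega> \<le> t} \<in> sets (path_before t)"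
      using T by (simp add: stopping_time_def pred_def)
    from path_algebra_sets_cong[OF this[unfolded path_before_def] \<omega>] show ?thesis
      using agree that \<omega> by (auto dest: order.strict_trans2)
  qed
  then have "T \<omega>' \<le> T \<omega>"
    by blast
  with *[of "T \<omega>'"] show ?thesis
    by auto
qed

lemma stopping_time_aug_before_cong:
  assumes T: "stopping_time aug_before T" and \<omega>: "\<omega> \<in> space aug" "\<omega>' \<in> space aug" "fst \<omega> = fst \<omega>'"
    and agree: "\<And>t. 0 \<le> t \<Longrightarrow> ennreal t < T \<omega> \<Longrightarrow> snd \<omega> t = snd \<omega>' t"
  shows "T \<omega>' = T \<omega>"
proof -
  have *: "T \<omega> \<le> t \<longleftrightarrow> T \<omega>' \<le> t" if "t \<le> T \<omega>" for t
  proof -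
    have "{\<omega> \<in> space (aug_before t). T \<omega> \<le> t} \<in> sets (aug_before t)"
      using T by (simp add: stopping_time_def pred_def)
    moreover have "space (aug_before t) = UNIV \<times> cadlag"
      by (simp add: aug_before_def path_before_def space_pair_measure)
    ultimately show ?thesis
      using aug_before_sets_cong[of "{\<omega> \<in> space (aug_before t). T \<omega> \<le> t}" t \<omega> \<omega>'] agree that \<omega>
      by (auto simp: mem_Times_iff space_aug dest: order.strict_trans2)
  qed
  then have "T \<omega>' \<le> T \<omega>"
    by blast
  with *[of "T \<omega>'"] show ?thesis
    by auto
qed

text \<open>By right-continuity, the value at time \<open>t\<close> is the limit of the values at the countably valued
  times \<open>(\<lfloor>t (n + 1)\<rfloor> + 1) / (n + 1)\<close>, which exceed \<open>t\<close> and tend to it.\<close>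

lemma measurable_path_eval_at:
  fixes g :: "'a \<Rightarrow> ('e::polish_space) path"
  assumes g [measurable]: "g \<in> M \<rightarrow>\<^sub>M path_F" and f [measurable]: "f \<in> borel_measurable M"
    and nonneg: "\<And>x. x \<in> space M \<Longrightarrow> 0 \<le> f x"
  shows "(\<lambda>x. g x (f x)) \<in> M \<rightarrow>\<^sub>M borel"
proof (rule borel_measurable_LIMSEQ_metric)
  define s where "s n x = (real (nat \<lfloor>f x * real (Suc n)\<rfloor>) + 1) / real (Suc n)" for n x
  have eval: "(\<lambda>x. g x t) \<in> M \<rightarrow>\<^sub>M borel" if "0 \<le> t" for t
    using measurable_compose[OF g measurable_path_eval[of t "{0..}"]] that by simp
  show "(\<lambda>x. g x (s n x)) \<in> M \<rightarrow>\<^sub>M borel" for n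
    unfolding s_def
  proof (rule measurable_compose_countable[where f = "\<lambda>m x. g x ((real m + 1) / real (Suc n))"])
    show "(\<lambda>x. nat \<lfloor>f x * real (Suc n)\<rfloor>) \<in> M \<rightarrow>\<^sub>M count_space UNIV"
      by measurable
  qed (rule eval, simp)
  fix x assume x: "x \<in> space M"
  have gt: "f x < s n x" and le: "s n x \<le> f x + 1 / real (Suc n)" for n
  proof -
    have "real (nat \<lfloor>f x * real (Suc n)\<rfloor>) = of_int \<lfloor>f x * real (Suc n)\<rfloor>"
      using nonneg[OF x] by simp
    then have "f x * real (Suc n) < real (nat \<lfloor>f x * real (Suc n)\<rfloor>) + 1"
      "real (nat \<lfloor>f x * real (Suc n)\<rfloor>) \<le> f x * real (Suc n)"
      by linarith+
    then show "f x < s n x" "s n x \<le> f x + 1 / real (Suc n)"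
      unfolding s_def by (simp_all add: pos_less_divide_eq divide_le_eq distrib_right)
  qed
  have "(\<lambda>n. s n x) \<longlonglongrightarrow> f x"
  proof (rule tendsto_sandwich[where f = "\<lambda>_. f x" and h = "\<lambda>n. f x + 1 / real (Suc n)"])
    show "(\<lambda>n. f x + 1 / real (Suc n)) \<longlonglongrightarrow> f x"
      using tendsto_add[OF tendsto_const LIMSEQ_inverse_real_of_nat, of "f x"]
      by (simp add: inverse_eq_divide)
    show "(\<lambda>n. f x) \<longlonglongrightarrow> f x"
      by simp
  qed (use gt le in \<open>auto intro!: always_eventually less_imp_le\<close>)
  then have "filterlim (\<lambda>n. s n x) (at_right (f x)) sequentially"
    using gt by (auto simp: filterlim_at intro!: always_eventually) (metis order_less_irrefl)
  moreover have "(g x \<longlongrightarrow> g x (f x)) (at_right (f x))"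
    using measurable_space[OF g x] nonneg[OF x] by (auto simp: cadlag_def)
  ultimately show "(\<lambda>n. g x (s n x)) \<longlonglongrightarrow> g x (f x)"
    by (rule filterlim_compose[rotated])
qed

section \<open>Regularity of pasted paths, checked one time at a time\<close>

definition cadlag_at :: "('e::polish_space) path \<Rightarrow> real \<Rightarrow> bool" where
  "cadlag_at \<omega> t \<longleftrightarrow> (\<omega> \<longlongrightarrow> \<omega> t) (at_right t) \<and> (0 < t \<longrightarrow> (\<exists>l. (\<omega> \<longlongrightarrow> l) (at_left t)))"

lemma cadlag_iff_cadlag_at: "\<omega> \<in> cadlag \<longleftrightarrow> \<omega> \<in> extensional {0..} \<and> (\<forall>t\<ge>0. cadlag_at \<omega> t)"
  by (auto simp: cadlag_def cadlag_at_def)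

text \<open>Agreement on \<open>[0,s)\<close> with \<open>t < s\<close> covers a neighbourhood of
  \<open>t\<close>. A pasted path agrees with a known cadlag path only locally, hence the pointwise
  form of the property.\<close>

lemma cadlag_at_cong:
  assumes \<omega>': "cadlag_at \<omega>' t" and t: "0 \<le> t" "t < s"
    and eq: "\<And>r. 0 \<le> r \<Longrightarrow> r < s \<Longrightarrow> \<omega> r = \<omega>' r"
  shows "cadlag_at \<omega> t"
  unfolding cadlag_at_def
proof (intro conjI impI)
  have "\<forall>\<^sub>F r in at_right t. \<omega>' r = \<omega> r"
    unfolding eventually_at_right_field using eq t by (intro exI[of _ s]) auto
  moreover have "(\<omega>' \<longlongrightarrow> \<omega> t) (at_right t)"
    using \<omega>' t by (simp add: cadlag_at_def eq)
  ultimately show "(\<omega> \<longlongrightarrow> \<omega> t) (at_right t)"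
    by (rule Lim_transform_eventually[rotated])
  assume "0 < t"
  then have "\<forall>\<^sub>F r in at_left t. \<omega>' r = \<omega> r"
    unfolding eventually_at_left_field using eq t by (intro exI[of _ 0]) auto
  moreover obtain l where "(\<omega>' \<longlongrightarrow> l) (at_left t)"
    using \<omega>' \<open>0 < t\<close> by (auto simp: cadlag_at_def)
  ultimately show "\<exists>l. (\<omega> \<longlongrightarrow> l) (at_left t)"
    using Lim_transform_eventually by blast
qed

text \<open>Supplies the real bound \<open>s\<close> for \<open>cadlag_at_cong\<close> when two
  paths agree up to a possibly infinite time \<open>T\<close>.\<close>

lemma ennreal_less_imp_real_between:
  assumes "ennreal t < T"
  obtains s where "t < s" "ennreal s \<le> T"
proof (cases T)
  case (real r)
  then show ?thesis
    using assms by (cases "0 \<le> t") (auto simp: ennreal_less_iff ennreal_neg intro: that[of r] that[of 0])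
next
  case top
  then show ?thesis
    by (intro that[of "t + 1"]) auto
qed

lemma const_path_cadlag: "(\<lambda>t\<in>{0..}. c) \<in> cadlag"
proof -
  have "cadlag_at (\<lambda>_. c) t" for t
    by (auto simp: cadlag_at_def)
  then have "cadlag_at (\<lambda>t\<in>{0..}. c) t" if "0 \<le> t" for t
    by (rule cadlag_at_cong[of _ t "t + 1"]) (use that in auto)
  then show ?thesis
    by (simp add: cadlag_iff_cadlag_at)
qed

text \<open>Before \<open>T\<close> the path is locally \<open>\<omega>\<close>, and after
  \<open>T\<close> it is locally a translate of \<open>\<omega>'\<close>. At \<open>T\<close> itself
  the left limit comes from \<open>\<omega>\<close>, the value and the right limit from
  \<open>\<omega>'\<close>, so the two paths need not match there.\<close>

lemma paste_in_space_aug: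
  assumes \<omega>: "\<omega> \<in> space aug" and \<omega>': "\<omega>' \<in> cadlag"
  shows "paste \<omega> T \<omega>' \<in> space aug"
proof -
  let ?p = "\<lambda>t\<in>{0..}. if ennreal t < T then snd \<omega> t else \<omega>' (t - enn2real T)"
  have c: "snd \<omega> \<in> cadlag"
    using \<omega> by (auto simp: space_aug)
  have before: "cadlag_at ?p t" if t: "0 \<le> t" "ennreal t < T" for t
  proof -
    obtain s where s: "t < s" "ennreal s \<le> T"
      using ennreal_less_imp_real_between[OF t(2)] .
    show ?thesis
    proof (rule cadlag_at_cong)
      show "cadlag_at (snd \<omega>) t"
        using c t by (simp add: cadlag_iff_cadlag_at)
      fix r assume "0 \<le> r" "r < s"
      then have "ennreal r < T"
        by (meson ennreal_less_iff order.strict_trans2 s(2))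
      then show "?p r = snd \<omega> r"
        using \<open>0 \<le> r\<close> by simp
    qed (use t s in auto)
  qed
  have after: "cadlag_at ?p t" if T: "T = ennreal a" "0 \<le> a" and t: "a \<le> t" for a t
    unfolding cadlag_at_def
  proof (intro conjI impI)
    have "(\<omega>' \<longlongrightarrow> \<omega>' (t - a)) (at_right (t - a))"
      using \<omega>' t by (auto simp: cadlag_def)
    moreover have "filterlim (\<lambda>r. r - a) (at_right (t - a)) (at_right t)"
      by (auto simp: filterlim_at eventually_at_right_field intro!: tendsto_intros exI[of _ "t + 1"])
    ultimately have "((\<lambda>r. \<omega>' (r - a)) \<longlongrightarrow> \<omega>' (t - a)) (at_right t)"
      by (rule filterlim_compose)
    moreover have "\<forall>\<^sub>F r in at_right t. \<omega>' (r - a) = ?p r"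
      unfolding eventually_at_right_field using t T
      by (intro exI[of _ "t + 1"]) (auto simp: ennreal_less_iff)
    ultimately have "(?p \<longlongrightarrow> \<omega>' (t - a)) (at_right t)"
      by (rule Lim_transform_eventually)
    moreover have "?p t = \<omega>' (t - a)"
      using t T by (auto simp: ennreal_less_iff)
    ultimately show "(?p \<longlongrightarrow> ?p t) (at_right t)"
      by simp
    assume pos: "0 < t"
    show "\<exists>l. (?p \<longlongrightarrow> l) (at_left t)"
    proof (cases "t = a")
      case True
      obtain l where "(snd \<omega> \<longlongrightarrow> l) (at_left t)"
        using c pos unfolding cadlag_def by (blast intro: less_imp_le)
      moreover have "\<forall>\<^sub>F r in at_left t. snd \<omega> r = ?p r"
        unfolding eventually_at_left_field using True pos T
        by (intro exI[of _ 0]) (auto simp: ennreal_less_iff)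
      ultimately have "(?p \<longlongrightarrow> l) (at_left t)"
        by (rule Lim_transform_eventually)
      then show ?thesis ..
    next
      case False
      then have "0 < t - a"
        using t by simp
      then obtain l where "(\<omega>' \<longlongrightarrow> l) (at_left (t - a))"
        using \<omega>' unfolding cadlag_def by (blast intro: less_imp_le)
      moreover have "filterlim (\<lambda>r. r - a) (at_left (t - a)) (at_left t)"
        by (auto simp: filterlim_at eventually_at_left_field intro!: tendsto_intros exI[of _ "t - 1"])
      ultimately have "((\<lambda>r. \<omega>' (r - a)) \<longlongrightarrow> l) (at_left t)"
        by (rule filterlim_compose)
      moreover have "\<forall>\<^sub>F r in at_left t. \<omega>' (r - a) = ?p r"
        unfolding eventually_at_left_field using t T False
        by (intro exI[of _ a]) (auto simp: ennreal_less_iff)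
      ultimately have "(?p \<longlongrightarrow> l) (at_left t)"
        by (rule Lim_transform_eventually)
      then show ?thesis ..
    qed
  qed
  have "cadlag_at ?p t" if "0 \<le> t" for t
  proof (cases "ennreal t < T")
    case True
    then show ?thesis
      using before that by blast
  next
    case False
    then obtain a where "T = ennreal a" "0 \<le> a"
      by (cases T) auto
    with False that show ?thesis
      by (intro after) (auto simp: ennreal_less_iff)
  qed
  then show ?thesis
    using \<omega> by (simp add: paste_def space_aug cadlag_iff_cadlag_at)
qed

section \<open>Impulse times along pasted paths\<close>

text \<open>A cycle as a function of the one path that drives it, with the cemetery convention of
  \<open>path_cycle\<close>. The lifetime is read off that path rather than off the impulse
  times.\<close>

definition first_cycle :: "('e path \<Rightarrow> ennreal) \<Rightarrow> 'e path \<Rightarrow> real \<Rightarrow> 'e option" where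
  "first_cycle \<sigma> \<omega> = (\<lambda>t\<in>{0..}. if ennreal t < \<sigma> \<omega> then Some (\<omega> t) else None)"

text \<open>Recovers the argument that \<open>\<sigma>\<close> receives after an impulse.
  \<open>T\<close> has to be finite because \<open>enn2real\<close> sends infinity to 0.\<close>

lemma shift_paste:
  assumes "T < \<infinity>" "\<omega>' \<in> cadlag"
  shows "shift T (paste \<omega> T \<omega>') = \<omega>'"
proof
  fix t :: real
  show "shift T (paste \<omega> T \<omega>') t = \<omega>' t"
  proof (cases "0 \<le> t")
    case True
    have "T \<le> T + ennreal t"
      by simp
    also have "T + ennreal t = ennreal (enn2real T + t)"
      using assms(1) True by (cases T) (auto simp: ennreal_plus)
    finally have "\<not> ennreal (enn2real T + t) < T"
      by (rule leD)
    then show ?thesis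
      using True by (simp add: shift_def paste_def del: ennreal_plus)
  next
    case False
    then show ?thesis
      using assms(2) by (auto simp: shift_def cadlag_def extensional_def)
  qed
qed

text \<open>The pathwise part of the setting, before any law of the paths is given. All lifetimes
  are the same function of a path, so the value at \<open>0-\<close> cannot influence them.\<close>

locale identical_cycles =
  fixes ZZ :: "'z measure"
    and Q :: "('e::polish_space) \<times> 'z \<Rightarrow> 'e measure"
    and \<tau> :: "nat \<Rightarrow> 'e apath \<Rightarrow> ennreal"
    and Z :: "nat \<Rightarrow> 'e apath \<Rightarrow> 'z"
    and \<sigma> :: "'e path \<Rightarrow> ennreal"
    and Q0 :: "'e measure"
  assumes policy: "independent_cycles_policy ZZ Q \<tau> Z (\<lambda>\<omega>. \<sigma> (snd \<omega>)) (\<lambda>_. \<sigma>) (\<lambda>_. Q0)"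
    and measurable_\<sigma> [measurable]: "\<sigma> \<in> borel_measurable path_F"
begin

lemma nominal: "nominal_policy ZZ \<tau> Z"
  using policy by (simp add: independent_cycles_policy_def)

lemma \<tau>_0: "\<omega> \<in> space aug \<Longrightarrow> \<tau> 0 \<omega> = 0"
  using nominal by (simp add: nominal_policy_def)

lemma \<tau>_le_Suc:
  assumes "\<omega> \<in> space aug"
  shows "\<tau> k \<omega> \<le> \<tau> (Suc k) \<omega>"
  using assms nominal \<tau>_0 by (cases "k = 0") (auto simp: nominal_policy_def)

text \<open>Joins the clause for the first impulse with that for the later ones: restarting at time
  0 changes nothing, since paths are \<open>undefined\<close> at negative times.\<close>

lemma \<tau>_Suc:
  assumes \<omega>: "\<omega> \<in> space aug" and fin: "\<tau> k \<omega> < \<infinity>"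
  shows "\<tau> (Suc k) \<omega> = \<tau> k \<omega> + \<sigma> (shift (\<tau> k \<omega>) \<omega>)"
proof (cases "k = 0")
  case True
  have "shift 0 \<omega> = snd \<omega>"
    using \<omega> by (auto simp: shift_def space_aug cadlag_def extensional_def)
  then show ?thesis
    using policy \<omega> True by (simp add: independent_cycles_policy_def \<tau>_0)
next
  case False
  have "\<forall>k\<ge>2. \<forall>\<omega>\<in>space aug. \<tau> (k - 1) \<omega> < \<infinity> \<longrightarrow> \<tau> k \<omega> = \<tau> (k - 1) \<omega> + \<sigma> (shift (\<tau> (k - 1) \<omega>) \<omega>)"
    using policy by (simp add: independent_cycles_policy_def)
  from this[rule_format, of "Suc k" \<omega>] show ?thesis
    using False \<omega> fin by simp
qed

text \<open>Galmarini's test in the version that fits the index: on augmented paths for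
  \<open>k = 1\<close>, on paths for \<open>k \<ge> 2\<close>.\<close>

lemma \<tau>_cong:
  assumes \<omega>: "\<omega> \<in> space aug" "\<omega>' \<in> space aug" "fst \<omega> = fst \<omega>'"
    and agree: "\<And>t. 0 \<le> t \<Longrightarrow> ennreal t < \<tau> k \<omega> \<Longrightarrow> snd \<omega> t = snd \<omega>' t"
  shows "\<tau> k \<omega>' = \<tau> k \<omega>"
proof -
  consider "k = 0" | "k = 1" | "k \<ge> 2"
    by linarith
  then show ?thesis
  proof cases
    case 2
    then show ?thesis
      using stopping_time_aug_before_cong[of "\<tau> 1" \<omega> \<omega>'] nominal \<omega> agree
      by (simp add: nominal_policy_def)
  next
    case 3
    then obtain T where T: "stopping_time path_before T" "\<And>\<omega>. \<omega> \<in> space aug \<Longrightarrow> \<tau> k \<omega> = T (snd \<omega>)"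
      using nominal unfolding nominal_policy_def by blast
    have "snd \<omega> \<in> cadlag" "snd \<omega>' \<in> cadlag"
      using \<omega> by (auto simp: space_aug)
    from stopping_time_path_before_cong[OF T(1) this] show ?thesis
      using T(2) \<omega> agree by simp
  qed (simp add: \<tau>_0 \<omega>)
qed

text \<open>If \<open>\<sigma> \<omega>\<close> were 0, the first impulse would come at time 0,
  restarting there would give \<open>\<omega>\<close> again, and the second impulse would come at
  time 0, too. Two impulses are needed for the contradiction because strict increase is required
  only from the first impulse on. The value at \<open>0-\<close> is arbitrary.\<close>

lemma \<sigma>_pos:
  assumes "\<omega> \<in> cadlag"
  shows "0 < \<sigma> \<omega>"
proof (rule ccontr)
  assume "\<not> 0 < \<sigma> \<omega>"
  then have 0: "\<sigma> \<omega> = 0"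
    by simp
  let ?\<omega> = "(undefined, \<omega>)"
  have \<omega>: "?\<omega> \<in> space aug"
    using assms by (simp add: space_aug)
  have s: "shift 0 ?\<omega> = \<omega>"
    using assms by (auto simp: shift_def cadlag_def extensional_def)
  have 1: "\<tau> 1 ?\<omega> = 0"
    using \<tau>_Suc[OF \<omega>, of 0] 0 s by (simp add: \<tau>_0[OF \<omega>])
  moreover have "\<tau> 2 ?\<omega> = 0"
    using \<tau>_Suc[OF \<omega>, of 1] 0 1 s by (simp add: numeral_2_eq_2)
  moreover have "\<tau> 1 ?\<omega> < \<infinity> \<longrightarrow> \<tau> 1 ?\<omega> < \<tau> (Suc 1) ?\<omega>"
    using nominal \<omega> unfolding nominal_policy_def by blast
  ultimately show False
    by (simp add: numeral_2_eq_2)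
qed

lemma measurable_\<tau> [measurable]: "\<tau> k \<in> borel_measurable aug"
proof -
  consider "k = 0" | "k = 1" | "k \<ge> 2"
    by linarith
  then show ?thesis
  proof cases
    case 1
    then show ?thesis
      using \<tau>_0 by (subst measurable_cong[where g = "\<lambda>_. 0"]) auto
  next
    case 2
    have "\<tau> 1 \<omega> = \<sigma> (snd \<omega>)" if "\<omega> \<in> space aug" for \<omega>
      using policy that by (simp add: independent_cycles_policy_def \<tau>_0)
    then have "\<tau> 1 \<in> borel_measurable aug \<longleftrightarrow> (\<lambda>\<omega>. \<sigma> (snd \<omega>)) \<in> borel_measurable aug"
      by (intro measurable_cong)
    with 2 show ?thesis
      by (simp add: aug_def)
  next
    case 3
    then obtain T where T: "stopping_time path_before T" "\<And>\<omega>. \<omega> \<in> space aug \<Longrightarrow> \<tau> k \<omega> = T (snd \<omega>)"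
      using nominal unfolding nominal_policy_def by blast
    have [measurable]: "T \<in> borel_measurable path_F"
    proof (rule borel_measurableI_le)
      fix t
      have "{\<omega> \<in> space (path_before t). T \<omega> \<le> t} \<in> sets (path_before t)"
        using T by (simp add: stopping_time_def pred_def)
      then show "{\<omega> \<in> space path_F. T \<omega> \<le> t} \<in> sets path_F"
        using sets_path_algebra_mono[of "{s. 0 \<le> s \<and> ennreal s < t}" "{0..}"]
        by (auto simp: path_before_def)
    qed
    have "(\<lambda>\<omega>. T (snd \<omega>)) \<in> borel_measurable aug"
      by (simp add: aug_def)
    then show ?thesis
      using T(2) by (subst measurable_cong) auto
  qed
qed

lemma ctrl_time_0 [simp]: "ctrl_time \<tau> 0 w = 0"
  by (simp add: ctrl_time_def)

lemma pasted_in_space_aug: "(\<And>i. i \<le> k \<Longrightarrow> snd w i \<in> cadlag) \<Longrightarrow> pasted \<tau> k w \<in> space aug"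
  by (induction k) (auto simp: space_aug intro!: paste_in_space_aug[unfolded space_aug])

lemma fst_pasted [simp]: "fst (pasted \<tau> k w) = fst w"
  by (induction k) (auto simp: paste_def)

lemma snd_pasted_Suc:
  assumes "0 \<le> t"
  shows "snd (pasted \<tau> (Suc k) w) t =
    (if ennreal t < ctrl_time \<tau> (Suc k) w then snd (pasted \<tau> k w) t
     else snd w (Suc k) (t - enn2real (ctrl_time \<tau> (Suc k) w)))"
  using assms by (simp add: paste_def ctrl_time_def)

text \<open>Pasting at an impulse time alters the path from that time on, which the impulse time
  does not see.\<close>

lemma \<tau>_pasted:
  assumes "\<And>i. i \<le> k \<Longrightarrow> snd w i \<in> cadlag"
  shows "\<tau> k (pasted \<tau> k w) = ctrl_time \<tau> k w"
proof (cases k)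
  case 0
  then show ?thesis
    using assms pasted_in_space_aug[of 0 w] \<tau>_0 by simp
next
  case (Suc j)
  have "\<tau> (Suc j) (pasted \<tau> (Suc j) w) = \<tau> (Suc j) (pasted \<tau> j w)"
  proof (rule \<tau>_cong)
    fix t assume "0 \<le> t" "ennreal t < \<tau> (Suc j) (pasted \<tau> j w)"
    then show "snd (pasted \<tau> j w) t = snd (pasted \<tau> (Suc j) w) t"
      by (simp add: paste_def)
  qed (use assms Suc in \<open>auto intro!: pasted_in_space_aug simp del: pasted.simps\<close>)
  with Suc show ?thesis
    by (simp add: ctrl_time_def)
qed

text \<open>By \<open>\<tau>_pasted\<close> the policy restarts the pasted path exactly where
  \<open>snd w k\<close> was inserted, so the shift uncovers \<open>snd w k\<close> and its
  recursion reads the lifetime off this path alone.\<close>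

lemma ctrl_time_Suc:
  assumes w: "\<And>i. i \<le> k \<Longrightarrow> snd w i \<in> cadlag"
  shows "ctrl_time \<tau> (Suc k) w = ctrl_time \<tau> k w + \<sigma> (snd w k)"
proof (cases "ctrl_time \<tau> k w < \<infinity>")
  case True
  have sp: "pasted \<tau> k w \<in> space aug"
    using w by (rule pasted_in_space_aug)
  have "shift (ctrl_time \<tau> k w) (pasted \<tau> k w) = snd w k"
  proof (cases k)
    case 0
    then show ?thesis
      using w[of 0] by (auto simp: shift_def cadlag_def extensional_def)
  next
    case (Suc j)
    then show ?thesis
      using True w[of k] by (simp add: shift_paste ctrl_time_def)
  qed
  then show ?thesis
    using \<tau>_Suc[OF sp, of k] True by (simp add: \<tau>_pasted[OF w] ctrl_time_def[of _ "Suc k"])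
next
  \<comment> \<open>The recursion is silent after an infinite time; monotonicity of the impulse
    times makes both sides infinite.\<close>
  case False
  then have "\<tau> k (pasted \<tau> k w) = \<infinity>"
    by (simp add: \<tau>_pasted[OF w] less_top[symmetric])
  then have "\<tau> (Suc k) (pasted \<tau> k w) = \<infinity>"
    using \<tau>_le_Suc[OF pasted_in_space_aug, of k w k] w by (simp add: top_unique)
  then show ?thesis
    using False by (simp add: ctrl_time_def[of _ "Suc k"] less_top[symmetric])
qed

lemma ctrl_time_eq_sum:
  "(\<And>i. i < k \<Longrightarrow> snd w i \<in> cadlag) \<Longrightarrow> ctrl_time \<tau> k w = (\<Sum>j<k. \<sigma> (snd w j))"
  by (induction k) (auto simp: ctrl_time_Suc less_Suc_eq_le)

text \<open>Here the constancy of \<open>Q\<close> along impulses enters: of the whole history, only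
  the question whether another impulse comes at all still matters.\<close>

lemma impulse_law_eq:
  assumes "\<And>i. i \<le> k \<Longrightarrow> snd w i \<in> cadlag"
  shows "impulse_law Q ebar \<tau> Z k w =
    (if (\<Sum>j\<le>k. \<sigma> (snd w j)) < \<infinity> then Q0 else return borel ebar)"
proof -
  have T: "ctrl_time \<tau> (Suc k) w = (\<Sum>j\<le>k. \<sigma> (snd w j))"
    using assms by (simp add: ctrl_time_eq_sum lessThan_Suc_atMost)
  have "\<forall>\<omega>\<in>space aug. \<tau> (Suc k) \<omega> < \<infinity> \<longrightarrow> Q (pre_impulse \<tau> (Suc k) \<omega>, Z (Suc k) \<omega>) = Q0"
    using policy by (simp add: independent_cycles_policy_def)
  then have "Q (pre_impulse \<tau> (Suc k) (pasted \<tau> k w), Z (Suc k) (pasted \<tau> k w)) = Q0"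
    if "ctrl_time \<tau> (Suc k) w < \<infinity>"
    using that pasted_in_space_aug[of k w] assms by (simp add: ctrl_time_def)
  then show ?thesis
    by (simp add: impulse_law_def T)
qed

section \<open>The controlled path at a fixed sample point\<close>

context
  fixes w :: "'e seqs"
  assumes w: "\<And>i. snd w i \<in> cadlag"
begin

lemma ctrl_time_mono: "i \<le> j \<Longrightarrow> ctrl_time \<tau> i w \<le> ctrl_time \<tau> j w"
  using w by (simp add: ctrl_time_eq_sum) (intro sum_mono2, auto)

text \<open>Every later paste takes place at \<open>ctrl_time \<tau> (Suc j) w\<close> or after it
  and leaves the interval of cycle \<open>j\<close> alone.\<close>

lemma snd_pasted_eq:
  assumes t: "0 \<le> t" "ctrl_time \<tau> j w \<le> ennreal t" "ennreal t < ctrl_time \<tau> (Suc j) w" and j: "j \<le> k"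
  shows "snd (pasted \<tau> k w) t = snd w j (t - enn2real (ctrl_time \<tau> j w))"
  using j
proof (induction k)
  case (Suc k)
  show ?case
  proof (cases "j = Suc k")
    case True
    then show ?thesis
      using t by (auto simp add: snd_pasted_Suc simp del: pasted.simps dest: leD)
  next
    case False
    then have "ennreal t < ctrl_time \<tau> (Suc k) w"
      using Suc.prems t(3) ctrl_time_mono[of "Suc j" "Suc k"] by auto
    then show ?thesis
      using False Suc t by (simp add: snd_pasted_Suc del: pasted.simps)
  qed
qed (use t in simp)

text \<open>Justifies the definite description in \<open>ctrl_path\<close>.\<close>

lemma ctrl_time_index_unique:
  assumes "ctrl_time \<tau> i w \<le> t" "t < ctrl_time \<tau> (Suc i) w"
    and "ctrl_time \<tau> j w \<le> t" "t < ctrl_time \<tau> (Suc j) w"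
  shows "i = j"
  using assms ctrl_time_mono[of "Suc i" j] ctrl_time_mono[of "Suc j" i]
  by (metis leD not_less_eq_eq order_trans nat_le_linear le_antisym)

text \<open>Take the least \<open>n\<close> whose time exceeds \<open>t\<close>. It is not 0,
  because the time with index 0 is 0, and its predecessor is the index sought.\<close>

lemma ctrl_time_index_le:
  assumes "t < ctrl_time \<tau> (Suc k) w"
  obtains j where "j \<le> k" "ctrl_time \<tau> j w \<le> t" "t < ctrl_time \<tau> (Suc j) w"
proof -
  define n where "n = (LEAST n. t < ctrl_time \<tau> n w)"
  have n: "t < ctrl_time \<tau> n w"
    unfolding n_def using assms by (rule LeastI)
  then obtain j where j: "n = Suc j"
    by (cases n) auto
  have "\<not> t < ctrl_time \<tau> j w"
    by (rule not_less_Least) (use j n_def in simp)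
  moreover have "n \<le> Suc k"
    unfolding n_def using assms by (rule Least_le)
  ultimately show ?thesis
    using that j n by simp
qed

context
  fixes ebar :: 'e
  assumes lim: "(\<lambda>k. ctrl_time \<tau> k w) \<longlonglongrightarrow> \<infinity>"
begin

lemma ctrl_time_exceeds:
  obtains k where "ennreal t < ctrl_time \<tau> (Suc k) w"
proof -
  have "\<forall>\<^sub>F k in sequentially. ennreal t < ctrl_time \<tau> k w"
    using lim by (rule order_tendstoD) simp
  then obtain k where "ennreal t < ctrl_time \<tau> k w"
    by (auto simp: eventually_sequentially)
  then have "ennreal t < ctrl_time \<tau> (Suc k) w"
    using ctrl_time_mono[of k "Suc k"] by auto
  then show ?thesis
    using that by blast
qed

lemma snd_ctrl_path_eq:
  assumes t: "0 \<le> t" "ctrl_time \<tau> j w \<le> ennreal t" "ennreal t < ctrl_time \<tau> (Suc j) w"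
  shows "snd (ctrl_path ebar \<tau> w) t = snd w j (t - enn2real (ctrl_time \<tau> j w))"
proof -
  have "(THE k. ctrl_time \<tau> k w \<le> ennreal t \<and> ennreal t < ctrl_time \<tau> (Suc k) w) = j"
    using t ctrl_time_index_unique by (intro the_equality) auto
  then show ?thesis
    using lim t by (simp add: ctrl_path_def Let_def)
qed

text \<open>The controlled path is an infinite pasting, but before any given impulse time finitely
  many pastes determine it. This carries both regularity and the stopping-time argument over to
  it.\<close>

lemma snd_ctrl_path_eq_pasted:
  assumes t: "0 \<le> t" "ennreal t < ctrl_time \<tau> (Suc k) w"
  shows "snd (ctrl_path ebar \<tau> w) t = snd (pasted \<tau> k w) t"
proof -
  obtain j where "j \<le> k" "ctrl_time \<tau> j w \<le> ennreal t" "ennreal t < ctrl_time \<tau> (Suc j) w"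
    using ctrl_time_index_le[OF t(2)] .
  then show ?thesis
    using t(1) by (simp add: snd_ctrl_path_eq snd_pasted_eq)
qed

lemma ctrl_path_in_space_aug_lim: "ctrl_path ebar \<tau> w \<in> space aug"
proof -
  have "cadlag_at (snd (ctrl_path ebar \<tau> w)) t" if t: "0 \<le> t" for t
  proof -
    obtain k where "ennreal t < ctrl_time \<tau> (Suc k) w"
      using ctrl_time_exceeds .
    then obtain s where s: "t < s" "ennreal s \<le> ctrl_time \<tau> (Suc k) w"
      using ennreal_less_imp_real_between by blast
    show ?thesis
    proof (rule cadlag_at_cong)
      show "cadlag_at (snd (pasted \<tau> k w)) t"
        using pasted_in_space_aug[of k w] w t by (auto simp: space_aug cadlag_iff_cadlag_at)
      fix r assume r: "0 \<le> r" "r < s"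
      then have "ennreal r < ctrl_time \<tau> (Suc k) w"
        using s by (meson ennreal_less_iff order.strict_trans2)
      then show "snd (ctrl_path ebar \<tau> w) r = snd (pasted \<tau> k w) r"
        using r by (simp add: snd_ctrl_path_eq_pasted)
    qed (use t s in auto)
  qed
  moreover have "snd (ctrl_path ebar \<tau> w) \<in> extensional {0..}"
    by (simp add: ctrl_path_def lim)
  ultimately show ?thesis
    by (simp add: space_aug mem_Times_iff cadlag_iff_cadlag_at)
qed

text \<open>The controlled path and \<open>pasted \<tau> j w\<close> agree strictly before
  \<open>ctrl_time \<tau> (Suc j) w\<close>, which is all that \<open>\<tau> (Suc j)\<close> looks
  at.\<close>

lemma \<tau>_ctrl_path: "\<tau> k (ctrl_path ebar \<tau> w) = ctrl_time \<tau> k w"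
proof (cases k)
  case 0
  then show ?thesis
    using \<tau>_0[OF ctrl_path_in_space_aug_lim] by simp
next
  case (Suc j)
  have "\<tau> (Suc j) (ctrl_path ebar \<tau> w) = \<tau> (Suc j) (pasted \<tau> j w)"
  proof (rule \<tau>_cong)
    fix t assume "0 \<le> t" "ennreal t < \<tau> (Suc j) (pasted \<tau> j w)"
    then show "snd (pasted \<tau> j w) t = snd (ctrl_path ebar \<tau> w) t"
      using snd_ctrl_path_eq_pasted[of t j] by (simp add: ctrl_time_def)
  next
    show "fst (pasted \<tau> j w) = fst (ctrl_path ebar \<tau> w)"
      by (simp add: ctrl_path_def)
  qed (use w in \<open>auto intro!: pasted_in_space_aug ctrl_path_in_space_aug_lim\<close>)
  with Suc show ?thesis
    by (simp add: ctrl_time_def)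
qed

lemma path_cycle_ctrl_path:
  "path_cycle \<tau> k (ctrl_path ebar \<tau> w) =
    (if ctrl_time \<tau> k w < \<infinity> then first_cycle \<sigma> (snd w k) else (\<lambda>t\<in>{0..}. None))"
proof
  fix t :: real
  let ?T = "ctrl_time \<tau> k w"
  have Suc: "ctrl_time \<tau> (Suc k) w = ?T + \<sigma> (snd w k)"
    using w by (intro ctrl_time_Suc)
  show "path_cycle \<tau> k (ctrl_path ebar \<tau> w) t =
    (if ?T < \<infinity> then first_cycle \<sigma> (snd w k) else (\<lambda>t\<in>{0..}. None)) t"
  proof (cases "0 \<le> t \<and> ?T < \<infinity>")
    case True
    then have t: "0 \<le> t" and fin: "?T \<noteq> \<infinity>"
      by auto
    \<comment> \<open>Cancelling \<open>?T\<close> is legitimate only because it is finite; an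
      infinite start gives the empty cycle instead.\<close>
    have iff: "?T + ennreal t < ?T + \<sigma> (snd w k) \<longleftrightarrow> ennreal t < \<sigma> (snd w k)"
      using fin by simp
    have sum: "ennreal (enn2real ?T + t) = ?T + ennreal t"
      using t fin by (cases ?T) (auto simp: ennreal_plus)
    have "snd (ctrl_path ebar \<tau> w) (enn2real ?T + t) = snd w k t" if "ennreal t < \<sigma> (snd w k)"
      using snd_ctrl_path_eq[of "enn2real ?T + t" k] that t iff by (simp add: sum Suc)
    then show ?thesis
      using True iff by (simp add: path_cycle_def first_cycle_def \<tau>_ctrl_path Suc)
  next
    case False
    then show ?thesis
      by (auto simp: path_cycle_def first_cycle_def \<tau>_ctrl_path Suc less_top[symmetric])
  qed
qed

end

text \<open>The constant default path makes this true at every sample point, as measurability into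
  \<open>aug\<close> requires.\<close>

lemma ctrl_path_in_space_aug: "ctrl_path ebar \<tau> w \<in> space aug"
proof (cases "(\<lambda>k. ctrl_time \<tau> k w) \<longlonglongrightarrow> \<infinity>")
  case False
  then show ?thesis
    by (simp add: ctrl_path_def space_aug const_path_cadlag)
qed (rule ctrl_path_in_space_aug_lim)

end

end

section \<open>Measurability of the cycles and of the controlled path\<close>

lemma measurable_Some [measurable]: "Some \<in> borel \<rightarrow>\<^sub>M (option_borel :: 'e::topological_space option measure)"
  unfolding option_borel_def
proof (rule measurable_measure_of)
  fix A :: "'e option set" assume "A \<in> insert {None} {Some ` B | B. B \<in> sets borel}"
  then consider "A = {None}" | B where "A = Some ` B" "B \<in> sets borel"
    by blast
  then show "Some -` A \<inter> space borel \<in> sets borel"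
  proof cases
    case 1
    then have "Some -` A = {}"
      by auto
    then show ?thesis
      by simp
  qed (simp add: inj_vimage_image_eq)
qed auto

lemma space_option_borel [simp]: "space option_borel = UNIV"
  by (simp add: option_borel_def space_measure_of_conv)

lemma measurable_first_cycle:
  assumes [measurable]: "\<sigma> \<in> borel_measurable path_F"
  shows "first_cycle \<sigma> \<in> path_F \<rightarrow>\<^sub>M cycle_space"
  unfolding cycle_space_def first_cycle_def
proof (rule measurable_restrict)
  fix t :: real assume t: "t \<in> {0..}"
  have [measurable]: "(\<lambda>\<omega>. Some (\<omega> t)) \<in> path_F \<rightarrow>\<^sub>M option_borel"
    using t by (rule measurable_compose[OF measurable_path_eval measurable_Some])
  show "(\<lambda>\<omega>. if ennreal t < \<sigma> \<omega> then Some (\<omega> t) else None) \<in> path_F \<rightarrow>\<^sub>M option_borel"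
    by measurable
qed

lemma space_seq_space: "space seq_space = {w. \<forall>i. snd w i \<in> cadlag}"
  by (auto simp: seq_space_def space_pair_measure space_PiM PiE_UNIV_domain)

lemma measurable_fst_seq_space [measurable]: "fst \<in> seq_space \<rightarrow>\<^sub>M borel"
  by (simp add: seq_space_def)

lemma measurable_snd_seq_space [measurable]: "(\<lambda>w. snd w k) \<in> seq_space \<rightarrow>\<^sub>M path_F"
  unfolding seq_space_def by measurable

context identical_cycles
begin

text \<open>Evaluation at the random time \<open>\<tau> k\<close> plus \<open>t\<close>. Where
  \<open>\<tau> k\<close> is infinite, \<open>enn2real\<close> puts 0 in its place, but the value
  obtained there is masked by \<open>None\<close>.\<close>

lemma measurable_path_cycle [measurable]: "path_cycle \<tau> k \<in> aug \<rightarrow>\<^sub>M cycle_space"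
  unfolding cycle_space_def path_cycle_def
proof (rule measurable_restrict)
  fix t :: real assume t: "t \<in> {0..}"
  have snd [measurable]: "snd \<in> aug \<rightarrow>\<^sub>M path_F"
    by (simp add: aug_def)
  have "(\<lambda>\<omega>. snd \<omega> (enn2real (\<tau> k \<omega>) + t)) \<in> aug \<rightarrow>\<^sub>M borel"
  proof (rule measurable_path_eval_at[OF snd])
    show "(\<lambda>\<omega>. enn2real (\<tau> k \<omega>) + t) \<in> borel_measurable aug"
      by measurable
  qed (use t in simp)
  then have [measurable]: "(\<lambda>\<omega>. Some (snd \<omega> (enn2real (\<tau> k \<omega>) + t))) \<in> aug \<rightarrow>\<^sub>M option_borel"
    by (rule measurable_compose[OF _ measurable_Some])
  show "(\<lambda>\<omega>. if \<tau> k \<omega> + ennreal t < \<tau> (Suc k) \<omega> then Some (snd \<omega> (enn2real (\<tau> k \<omega>) + t)) else None)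
    \<in> aug \<rightarrow>\<^sub>M option_borel"
    by measurable
qed

lemma measurable_ctrl_time [measurable]: "ctrl_time \<tau> k \<in> borel_measurable seq_space"
proof -
  have "ctrl_time \<tau> k \<in> borel_measurable seq_space \<longleftrightarrow>
      (\<lambda>w. \<Sum>j<k. \<sigma> (snd w j)) \<in> borel_measurable seq_space"
    by (intro measurable_cong) (simp add: ctrl_time_eq_sum space_seq_space)
  then show ?thesis
    by simp
qed

text \<open>The times are partial sums of lifetimes, so they always converge in
  \<open>ennreal\<close>. Absence of accumulation becomes divergence of a series, which is a
  measurable condition.\<close>

lemma ctrl_time_tendsto_iff:
  assumes "\<And>i. snd w i \<in> cadlag"
  shows "(\<lambda>k. ctrl_time \<tau> k w) \<longlonglongrightarrow> \<infinity> \<longleftrightarrow> (\<Sum>j. \<sigma> (snd w j)) = \<infinity>"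
proof -
  have "(\<lambda>k. ctrl_time \<tau> k w) \<longlonglongrightarrow> (\<Sum>j. \<sigma> (snd w j))"
    using assms by (simp add: ctrl_time_eq_sum summable_LIMSEQ)
  then show ?thesis
    by (metis LIMSEQ_unique)
qed

lemma measurable_ctrl_path [measurable]: "ctrl_path ebar \<tau> \<in> seq_space \<rightarrow>\<^sub>M aug"
  unfolding aug_def
proof (rule measurable_pair)
  show "fst \<circ> ctrl_path ebar \<tau> \<in> seq_space \<rightarrow>\<^sub>M borel"
    by (simp add: comp_def ctrl_path_def)
  show "snd \<circ> ctrl_path ebar \<tau> \<in> seq_space \<rightarrow>\<^sub>M path_F"
  proof (rule measurable_into_path)
    fix w :: "'e seqs" assume "w \<in> space seq_space"
    then show "(snd \<circ> ctrl_path ebar \<tau>) w \<in> cadlag"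
      using ctrl_path_in_space_aug[of w ebar] by (auto simp: space_seq_space space_aug)
  next
    fix t :: real assume "t \<in> {0..}"
    then have t: "0 \<le> t"
      by simp
    \<comment> \<open>A least index has evident measurability; on the event of divergence it is the
      index described in \<open>ctrl_path\<close>.\<close>
    define N where "N w = (LEAST k. ennreal t < ctrl_time \<tau> (Suc k) w)" for w :: "'e seqs"
    have [measurable]: "N \<in> seq_space \<rightarrow>\<^sub>M count_space UNIV"
      unfolding N_def by measurable
    \<comment> \<open>The maximum keeps the evaluation time nonnegative for every \<open>k\<close>
      and \<open>w\<close>, as \<open>measurable_path_eval_at\<close> demands. It has no effect at
      the index \<open>N w\<close> on the event of divergence.\<close>
    define v where "v k w = snd w k (max 0 (t - enn2real (ctrl_time \<tau> k w)))" for k and w :: "'e seqs"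
    have v: "v k \<in> seq_space \<rightarrow>\<^sub>M borel" for k
      unfolding v_def by (rule measurable_path_eval_at) auto
    have [measurable]: "(\<lambda>w. v (N w) w) \<in> seq_space \<rightarrow>\<^sub>M borel"
      by (rule measurable_compose_countable[OF v]) measurable
    have "(\<lambda>w. if (\<Sum>j. \<sigma> (snd w j)) = \<infinity> then v (N w) w else ebar) \<in> seq_space \<rightarrow>\<^sub>M borel"
      by measurable
    also have "?this \<longleftrightarrow> (\<lambda>w. (snd \<circ> ctrl_path ebar \<tau>) w t) \<in> seq_space \<rightarrow>\<^sub>M borel"
    proof (rule measurable_cong)
      fix w :: "'e seqs" assume "w \<in> space seq_space"
      then have w: "snd w i \<in> cadlag" for i
        by (simp add: space_seq_space)
      show "(if (\<Sum>j. \<sigma> (snd w j)) = \<infinity> then v (N w) w else ebar) = (snd \<circ> ctrl_path ebar \<tau>) w t"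
      proof (cases "(\<Sum>j. \<sigma> (snd w j)) = \<infinity>")
        case True
        then have lim: "(\<lambda>k. ctrl_time \<tau> k w) \<longlonglongrightarrow> \<infinity>"
          by (rule iffD2[OF ctrl_time_tendsto_iff[OF w]])
        obtain k where "ennreal t < ctrl_time \<tau> (Suc k) w"
          using ctrl_time_exceeds[OF w lim] .
        then have N: "ennreal t < ctrl_time \<tau> (Suc (N w)) w"
          unfolding N_def by (rule LeastI)
        have le: "ctrl_time \<tau> (N w) w \<le> ennreal t"
        proof (cases "N w")
          case (Suc j)
          then have "\<not> ennreal t < ctrl_time \<tau> (Suc j) w"
            by (intro not_less_Least) (simp add: N_def[symmetric])
          then show ?thesis
            by (simp add: Suc)
        qed simp
        then have "enn2real (ctrl_time \<tau> (N w) w) \<le> t"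
          using t by (rule enn2real_leI[rotated])
        then show ?thesis
          using snd_ctrl_path_eq[OF w lim t le N] True by (simp add: v_def)
      next
        case False
        then show ?thesis
          using t ctrl_time_tendsto_iff[OF w] by (simp add: ctrl_path_def)
      qed
    qed
    finally show "(\<lambda>w. (snd \<circ> ctrl_path ebar \<tau>) w t) \<in> seq_space \<rightarrow>\<^sub>M borel" .
  qed
qed

end

section \<open>Laws with given kernels\<close>

lemma hist_in_hist_space:
  "w \<in> space seq_space \<Longrightarrow> hist k w \<in> space (hist_space k)"
  by (auto simp: hist_def hist_space_def space_seq_space space_pair_measure space_PiM)

lemma space_hist_space: "space (hist_space k) = {h. snd h \<in> {..k} \<rightarrow>\<^sub>E cadlag}"
  by (auto simp: hist_space_def space_pair_measure space_PiM)

lemma measurable_hist [measurable]: "hist k \<in> seq_space \<rightarrow>\<^sub>M hist_space k"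
  unfolding hist_def hist_space_def seq_space_def by measurable

lemma measurable_hist_hist:
  assumes "k \<le> n"
  shows "hist k \<in> hist_space n \<rightarrow>\<^sub>M hist_space k"
  unfolding hist_def hist_space_def
proof (rule measurable_Pair)
  show "(\<lambda>w. restrict (snd w) {..k}) \<in> borel \<Otimes>\<^sub>M (\<Pi>\<^sub>M i\<in>{..n}. path_F) \<rightarrow>\<^sub>M (\<Pi>\<^sub>M i\<in>{..k}. path_F)"
    using assms by (intro measurable_compose[OF measurable_snd] measurable_restrict_subset) auto
qed measurable

lemma hist_hist: "k \<le> n \<Longrightarrow> hist k (hist n w) = hist k w"
  by (auto simp: hist_def)

lemma measurable_fst_hist_space [measurable]: "fst \<in> hist_space k \<rightarrow>\<^sub>M borel"
  by (simp add: hist_space_def)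

lemma measurable_snd_hist_space:
  assumes "i \<le> k"
  shows "(\<lambda>h. snd h i) \<in> hist_space k \<rightarrow>\<^sub>M path_F"
  unfolding hist_space_def
  using assms by (intro measurable_compose[OF measurable_snd] measurable_component_singleton) auto

abbreviation cylinders :: "('e::polish_space) seqs set set" where
  "cylinders \<equiv> {hist k -` A \<inter> space seq_space | k A. A \<in> sets (hist_space k)}"

text \<open>Both cylinders are rewritten over the longer of the two histories, from which the
  shorter one is recovered.\<close>

lemma Int_stable_cylinders: "Int_stable cylinders"
proof (rule Int_stableI)
  fix X Y :: "'a seqs set" assume "X \<in> cylinders" "Y \<in> cylinders"
  then obtain i A j B where X: "X = hist i -` A \<inter> space seq_space" "A \<in> sets (hist_space i)"
    and Y: "Y = hist j -` B \<inter> space seq_space" "B \<in> sets (hist_space j)"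
    by blast
  let ?n = "max i j"
  let ?C = "(hist i -` A \<inter> space (hist_space ?n)) \<inter> (hist j -` B \<inter> space (hist_space ?n))"
  have "?C \<in> sets (hist_space ?n)"
    using X Y by (intro sets.Int measurable_sets[OF measurable_hist_hist]) auto
  moreover have "X \<inter> Y = hist ?n -` ?C \<inter> space seq_space"
  proof (rule set_eqI)
    fix w show "w \<in> X \<inter> Y \<longleftrightarrow> w \<in> hist ?n -` ?C \<inter> space seq_space"
      using X Y hist_in_hist_space[of w ?n] hist_hist[of i ?n w] hist_hist[of j ?n w] by auto
  qed
  ultimately show "X \<inter> Y \<in> cylinders"
    by blast
qed

text \<open>Each coordinate is a function of a finite history, so the identity is measurable from
  the cylinder \<sigma>-algebra to \<open>seq_space\<close>.\<close>

lemma sets_seq_space_cylinders: "sets seq_space = sigma_sets (space seq_space) cylinders"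
proof
  define S where "S = sigma (space seq_space) (cylinders :: 'a seqs set set)"
  have S: "sets S = sigma_sets (space seq_space) cylinders" "space S = space seq_space"
    unfolding S_def by (auto intro!: sets_measure_of space_measure_of)
  have hist: "hist k \<in> S \<rightarrow>\<^sub>M hist_space k" for k
  proof (rule measurableI)
    fix A :: "'a seqs set" assume "A \<in> sets (hist_space k)"
    then show "hist k -` A \<inter> space S \<in> sets S"
      unfolding S by (intro sigma_sets.Basic) blast
  qed (simp add: S(2) hist_in_hist_space)
  have comp: "(\<lambda>w. snd w i) \<in> S \<rightarrow>\<^sub>M path_F" for i
    using measurable_compose[OF hist[of i] measurable_snd_hist_space[of i i]] by (simp add: hist_def)
  have "(\<lambda>w. w) \<in> S \<rightarrow>\<^sub>M seq_space"
    unfolding seq_space_def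
  proof (rule measurable_pair)
    show "fst \<circ> (\<lambda>w. w) \<in> S \<rightarrow>\<^sub>M borel"
      using measurable_compose[OF hist[of 0] measurable_fst_hist_space] by (simp add: hist_def comp_def)
    have "(\<lambda>w i. snd w i) \<in> S \<rightarrow>\<^sub>M (\<Pi>\<^sub>M k\<in>UNIV. path_F)"
      by (rule measurable_PiM_single') (use comp in \<open>auto simp: S(2) space_seq_space\<close>)
    then show "snd \<circ> (\<lambda>w. w) \<in> S \<rightarrow>\<^sub>M (\<Pi>\<^sub>M k\<in>UNIV. path_F)"
      by (simp add: comp_def)
  qed
  note id = this
  show "sets seq_space \<subseteq> sigma_sets (space seq_space) (cylinders :: 'a seqs set set)"
  proof
    fix X :: "'a seqs set" assume X: "X \<in> sets seq_space"
    have "(\<lambda>w. w) -` X \<inter> space S = X"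
      using sets.sets_into_space[OF X] by (auto simp: S(2))
    with measurable_sets[OF id X] show "X \<in> sigma_sets (space seq_space) cylinders"
      by (simp add: S(1))
  qed
next
  show "sigma_sets (space seq_space) cylinders \<subseteq> sets (seq_space :: 'a seqs measure)"
    by (rule sets.sigma_sets_subset) (auto intro: measurable_sets[OF measurable_hist])
qed

text \<open>Measurability of the kernel in the history turns the kernel condition into an integral
  against the law of \<open>hist k\<close>. So this law fixes the joint law of the history and the
  next path on rectangles, hence the law of the next history; the induction starts from
  \<open>M0\<close>.\<close>

lemma has_kernels_distr_hist_eq:
  fixes M M' :: "('e::polish_space) seqs measure"
  assumes M: "has_kernels M0 K M" and M': "has_kernels M0 K M'"
    and K: "\<And>k F. F \<in> sets path_F \<Longrightarrow> (\<lambda>h. emeasure (K k h) F) \<in> borel_measurable (hist_space k)"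
  shows "distr M (hist_space k) (hist k) = distr M' (hist_space k) (hist k)"
proof (induction k)
  case 0
  define g where "g = (\<lambda>\<omega>::'e apath. (fst \<omega>, \<lambda>i\<in>{..0::nat}. snd \<omega>))"
  have g: "g \<in> aug \<rightarrow>\<^sub>M hist_space 0"
    unfolding g_def aug_def hist_space_def by measurable
  have "distr N (hist_space 0) (hist 0) = distr M0 (hist_space 0) g" if "has_kernels M0 K N" for N
  proof -
    have N: "distr N aug (\<lambda>w. (fst w, snd w 0)) = M0"
      and [measurable_cong]: "sets N = sets seq_space"
      using that by (auto simp: has_kernels_def space_prob_algebra)
    have m: "(\<lambda>w. (fst w, snd w 0)) \<in> N \<rightarrow>\<^sub>M aug"
      unfolding aug_def by measurable
    have "hist 0 = g \<circ> (\<lambda>w. (fst w, snd w 0))"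
      by (auto simp: g_def hist_def restrict_def fun_eq_iff)
    then show ?thesis
      unfolding N[symmetric] by (simp add: distr_distr[OF g m])
  qed
  with M M' show ?case
    by metis
next
  case (Suc k)
  let ?H = "hist_space k \<Otimes>\<^sub>M path_F"
  let ?h = "\<lambda>w. (hist k w, snd w (Suc k))"
  define g where "g = (\<lambda>(h :: 'e seqs, \<omega>). (fst h, (snd h)(Suc k := \<omega>)))"
  have g: "g \<in> ?H \<rightarrow>\<^sub>M hist_space (Suc k)"
    unfolding g_def hist_space_def case_prod_beta
  proof (rule measurable_Pair)
    show "(\<lambda>x. (snd (fst x))(Suc k := snd x))
      \<in> (borel \<Otimes>\<^sub>M (\<Pi>\<^sub>M i\<in>{..k}. path_F)) \<Otimes>\<^sub>M path_F \<rightarrow>\<^sub>M (\<Pi>\<^sub>M i\<in>{..Suc k}. path_F)"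
      by (rule measurable_fun_upd[where J = "{..k}"]) (auto simp: atMost_Suc)
  qed measurable
  have h_g: "hist (Suc k) = g \<circ> ?h"
    by (auto simp: g_def hist_def fun_eq_iff)
  have h_meas: "?h \<in> N \<rightarrow>\<^sub>M ?H" if "has_kernels M0 K N" for N
  proof -
    have [measurable_cong]: "sets N = sets seq_space"
      using that by (auto simp: has_kernels_def space_prob_algebra)
    show ?thesis
      by measurable
  qed
  have rect: "emeasure (distr N ?H ?h) (A \<times> F) =
      (\<integral>\<^sup>+h. indicator A h * emeasure (K k h) F \<partial>distr N (hist_space k) (hist k))"
    if N: "has_kernels M0 K N" and A [measurable]: "A \<in> sets (hist_space k)" and F: "F \<in> sets path_F" for N A F
  proof -
    have s [measurable_cong]: "sets N = sets seq_space"
      using N by (auto simp: has_kernels_def space_prob_algebra)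
    note sp = sets_eq_imp_space_eq[OF s]
    note K[OF F, of k, measurable]
    have "emeasure (distr N ?H ?h) (A \<times> F) =
        emeasure N {w \<in> space seq_space. hist k w \<in> A \<and> snd w (Suc k) \<in> F}"
      using A F by (subst emeasure_distr[OF h_meas[OF N]]) (auto simp: sp intro!: arg_cong[where f = "emeasure N"])
    also have "\<dots> = (\<integral>\<^sup>+w. indicator A (hist k w) * emeasure (K k (hist k w)) F \<partial>N)"
      using N A F by (simp add: has_kernels_def nn_integral_completion)
    also have "\<dots> = (\<integral>\<^sup>+h. indicator A h * emeasure (K k h) F \<partial>distr N (hist_space k) (hist k))"
      by (subst nn_integral_distr) measurable
    finally show ?thesis .
  qed
  have "distr M ?H ?h = distr M' ?H ?h"
  proof (rule measure_eqI_generator_eq[where A = "\<lambda>_. space ?H"])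
    let ?E = "{a \<times> b | a b. a \<in> sets (hist_space k) \<and> b \<in> sets path_F} :: ('e seqs \<times> 'e path) set set"
    show "Int_stable ?E"
      by (rule Int_stable_pair_measure_generator)
    show "?E \<subseteq> Pow (space ?H)"
      unfolding space_pair_measure by (rule pair_measure_closed)
    show "emeasure (distr M ?H ?h) X = emeasure (distr M' ?H ?h) X" if "X \<in> ?E" for X
      using that rect[OF M] rect[OF M'] Suc by auto
    show "range (\<lambda>_. space ?H) \<subseteq> ?E"
      using sets.top[of "hist_space k"] sets.top[of path_F] unfolding space_pair_measure by blast
    interpret prob_space M
      using M by (simp add: has_kernels_def space_prob_algebra)
    interpret D: prob_space "distr M ?H ?h"
      by (rule prob_space_distr[OF h_meas[OF M]])
    show "emeasure (distr M ?H ?h) (space ?H) \<noteq> \<infinity>"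
      by simp
  qed (auto simp: sets_pair_measure space_pair_measure)
  then show ?case
    unfolding h_g distr_distr[OF g h_meas[OF M], symmetric] distr_distr[OF g h_meas[OF M'], symmetric]
    by simp
qed

text \<open>The uniqueness half of the Ionescu Tulcea theorem, which lets the definite description
  in \<open>seq_law\<close> be evaluated.\<close>

lemma has_kernels_unique:
  fixes M M' :: "('e::polish_space) seqs measure"
  assumes M: "has_kernels M0 K M" and M': "has_kernels M0 K M'"
    and K: "\<And>k F. F \<in> sets path_F \<Longrightarrow> (\<lambda>h. emeasure (K k h) F) \<in> borel_measurable (hist_space k)"
  shows "M = M'"
proof (rule measure_eqI_generator_eq[where A = "\<lambda>_. space seq_space"])
  have sets: "sets M = sets seq_space" "sets M' = sets seq_space" and prob: "prob_space M"
    using M M' by (auto simp: has_kernels_def space_prob_algebra)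
  note space = sets[THEN sets_eq_imp_space_eq]
  show "Int_stable (cylinders :: 'e seqs set set)"
    by (rule Int_stable_cylinders)
  show "emeasure M X = emeasure M' X" if X: "X \<in> cylinders" for X
  proof -
    obtain k A where X: "X = hist k -` A \<inter> space seq_space" and A: "A \<in> sets (hist_space k)"
      using X by blast
    have "emeasure N X = emeasure (distr N (hist_space k) (hist k)) A" if "sets N = sets seq_space" for N
    proof -
      note [measurable_cong] = that
      show ?thesis
        using A by (simp add: emeasure_distr X sets_eq_imp_space_eq[OF that])
    qed
    then show ?thesis
      using sets has_kernels_distr_hist_eq[OF M M' K] by simp
  qed
  show "range (\<lambda>_. space seq_space) \<subseteq> (cylinders :: 'e seqs set set)"
  proof -
    have "space seq_space = hist 0 -` space (hist_space 0) \<inter> (space seq_space :: 'e seqs set)"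
      using hist_in_hist_space by auto
    then show ?thesis
      by blast
  qed
  show "emeasure M (space seq_space) \<noteq> \<infinity>"
    using prob_space.emeasure_space_1[OF prob] by (simp add: space)
  show "cylinders \<subseteq> Pow (space (seq_space :: 'e seqs measure))"
    by blast
  show "sets M = sigma_sets (space seq_space) cylinders" "sets M' = sigma_sets (space seq_space) cylinders"
    unfolding sets by (fact sets_seq_space_cylinders)+
qed simp

text \<open>Cut the sequence before entry \<open>k\<close>: by \<open>PiM_comb_seq\<close> the tail
  may be replaced by an independent sequence \<open>s'\<close>. Then entry \<open>k\<close> is
  \<open>s' 0\<close>, while \<open>g\<close> sees only the part before the cut, and Fubini
  applies.\<close>

lemma (in sequence_space) nn_integral_fresh_coordinate:
  assumes g [measurable]: "case_prod g \<in> borel_measurable (S \<Otimes>\<^sub>M M)"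
    and dep: "\<And>s s' a. (\<And>j. j < k \<Longrightarrow> s j = s' j) \<Longrightarrow> g s a = g s' a"
  shows "(\<integral>\<^sup>+s. g s (s k) \<partial>S) = (\<integral>\<^sup>+s. \<integral>\<^sup>+a. g s a \<partial>M \<partial>S)"
proof -
  have m [measurable]: "(\<lambda>s. s k) \<in> S \<rightarrow>\<^sub>M M"
    by measurable
  have [measurable]: "(\<lambda>s. g s (s k)) \<in> borel_measurable S"
    using measurable_compose[OF measurable_Pair[OF measurable_ident_sets[OF refl] m] g] by simp
  have "(\<integral>\<^sup>+s. g s (s k) \<partial>S) = (\<integral>\<^sup>+s. g s (s k) \<partial>distr (S \<Otimes>\<^sub>M S) S (\<lambda>(s, s'). comb_seq k s s'))"
    by (simp add: PiM_comb_seq)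
  also have "\<dots> = (\<integral>\<^sup>+p. g (comb_seq k (fst p) (snd p)) (comb_seq k (fst p) (snd p) k) \<partial>(S \<Otimes>\<^sub>M S))"
    by (subst nn_integral_distr) (auto simp: case_prod_beta)
  also have "\<dots> = (\<integral>\<^sup>+p. g (fst p) (snd p 0) \<partial>(S \<Otimes>\<^sub>M S))"
  proof (intro nn_integral_cong)
    fix p
    have "g (comb_seq k (fst p) (snd p)) a = g (fst p) a" for a
      by (rule dep) (simp add: comb_seq_less)
    then show "g (comb_seq k (fst p) (snd p)) (comb_seq k (fst p) (snd p) k) = g (fst p) (snd p 0)"
      by (simp add: comb_seq_def)
  qed
  also have "\<dots> = (\<integral>\<^sup>+s. \<integral>\<^sup>+s'. g s (s' 0) \<partial>S \<partial>S)"
    by (subst P.nn_integral_fst[symmetric]) (auto)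
  also have "\<dots> = (\<integral>\<^sup>+s. \<integral>\<^sup>+a. g s a \<partial>M \<partial>S)"
  proof (rule nn_integral_cong)
    fix s assume "s \<in> space S"
    then have [measurable]: "g s \<in> borel_measurable M"
      using measurable_compose[OF measurable_Pair1' g] by simp
    have "(\<integral>\<^sup>+a. g s a \<partial>M) = (\<integral>\<^sup>+a. g s a \<partial>distr S M (\<lambda>s. s 0))"
      using distr_PiM_component[of "UNIV :: nat set" "\<lambda>_. M" 0] by (simp add: M.prob_space_axioms)
    then show "(\<integral>\<^sup>+s'. g s (s' 0) \<partial>S) = (\<integral>\<^sup>+a. g s a \<partial>M)"
      by (simp add: nn_integral_distr)
  qed
  finally show ?thesis .
qed

section \<open>Realization on a product space\<close>

lemma return_in_prob_algebra: "return borel x \<in> space (prob_algebra borel)"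
  by (simp add: space_prob_algebra prob_space_return)

text \<open>The initial path is kept outside the noise because its law depends on the initial point;
  therefore noise entry \<open>j\<close> serves cycle \<open>j + 1\<close>.\<close>

definition fresh :: "'e path \<Rightarrow> (nat \<Rightarrow> 'e path \<times> 'e path) \<Rightarrow> nat \<Rightarrow> 'e path" where
  "fresh \<omega> s k = (case k of 0 \<Rightarrow> \<omega> | Suc j \<Rightarrow> fst (s j))"

lemma fresh_simps [simp]: "fresh \<omega> s 0 = \<omega>" "fresh \<omega> s (Suc j) = fst (s j)"
  by (simp_all add: fresh_def)

locale controlled_cycles = identical_cycles ZZ Q \<tau> Z \<sigma> Q0
  for ZZ :: "'z measure"
    and Q :: "('e::polish_space) \<times> 'z \<Rightarrow> 'e measure"
    and \<tau> :: "nat \<Rightarrow> 'e apath \<Rightarrow> ennreal"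
    and Z :: "nat \<Rightarrow> 'e apath \<Rightarrow> 'z"
    and \<sigma> :: "'e path \<Rightarrow> ennreal"
    and Q0 :: "'e measure" +
  fixes P :: "'e \<Rightarrow> 'e path measure" and ebar :: 'e
  assumes markov: "markov_family P"
    and Q0: "Q0 \<in> space (prob_algebra borel)"
begin

lemma P_in_prob_algebra: "P x \<in> space (prob_algebra path_F)"
  using markov by (simp add: markov_family_def)

lemma sets_P [measurable_cong]: "sets (P x) = sets path_F"
  using P_in_prob_algebra by (simp add: space_prob_algebra)

lemma prob_space_P: "prob_space (P x)"
  using P_in_prob_algebra by (simp add: space_prob_algebra)

lemma completion_in_prob_algebra:
  assumes "\<kappa> \<in> space (prob_algebra borel)"
  shows "completion \<kappa> \<in> space (prob_algebra (completion \<kappa>))"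
  using assms by (simp add: space_prob_algebra prob_space.prob_space_completion)

text \<open>Universal measurability, specialized to \<open>\<kappa>\<close>, is measurability for
  its completion. This is why starting points are averaged against
  \<open>completion \<kappa>\<close>.\<close>

lemma measurable_P:
  assumes \<kappa>: "\<kappa> \<in> space (prob_algebra borel)"
  shows "P \<in> completion \<kappa> \<rightarrow>\<^sub>M prob_algebra path_F"
proof (intro measurable_prob_algebraI measurable_subprob_algebra prob_space_P)
  show "subprob_space (P x)" for x
    using prob_space_P by (rule prob_space_imp_subprob_space)
  fix F :: "'e path set" assume "F \<in> sets path_F"
  then have "(\<lambda>x. measure (P x) F) \<in> borel_measurable (completion \<kappa>)"
    using markov \<kappa> by (auto simp: markov_family_def universally_measurable_def)
  then have "(\<lambda>x. ennreal (measure (P x) F)) \<in> borel_measurable (completion \<kappa>)"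
    by simp
  moreover have "ennreal (measure (P x) F) = emeasure (P x) F" for x
    using prob_space_P[of x] by (intro finite_measure.emeasure_eq_measure[symmetric]) (simp add: prob_space_def)
  ultimately show "(\<lambda>x. emeasure (P x) F) \<in> borel_measurable (completion \<kappa>)"
    by simp
qed (rule sets_P)

text \<open>The law of a path whose starting point has distribution \<open>\<kappa>\<close>. The
  step kernels have this form with \<open>Q0\<close> or the point mass at \<open>ebar\<close>, and
  so does the averaged law of the initial path, with \<open>\<nu>\<close>.\<close>

definition renewal :: "'e measure \<Rightarrow> 'e path measure" where
  "renewal \<kappa> = completion \<kappa> \<bind> P"

lemma renewal_in_prob_algebra:
  assumes "\<kappa> \<in> space (prob_algebra borel)"
  shows "renewal \<kappa> \<in> space (prob_algebra path_F)"
  using prob_space_bind'[OF completion_in_prob_algebra measurable_P, OF assms assms]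
    sets_bind'[OF completion_in_prob_algebra measurable_P, OF assms assms]
  by (simp add: renewal_def space_prob_algebra)

text \<open>In the \<open>k\<close>-th factor, the first component is the path that starts the \<open>k+1\<close>-st cycle and the
  second one is used in place of it if the impulse never comes.\<close>

definition noise :: "(nat \<Rightarrow> 'e path \<times> 'e path) measure" where
  "noise = (\<Pi>\<^sub>M k\<in>UNIV. renewal Q0 \<Otimes>\<^sub>M renewal (return borel ebar))"

text \<open>For \<open>k = 0\<close> the condition is vacuous, so the truncated difference
  \<open>k - 1\<close> is harmless. The spare path has the law that the kernel prescribes after an
  infinite time.\<close>

definition realize :: "'e \<Rightarrow> 'e path \<Rightarrow> (nat \<Rightarrow> 'e path \<times> 'e path) \<Rightarrow> 'e seqs" where
  "realize x \<omega> s =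
    (x, \<lambda>k. if \<forall>j<k. \<sigma> (fresh \<omega> s j) < \<infinity> then fresh \<omega> s k else snd (s (k - 1)))"

lemma sets_renewal [measurable_cong]:
  "sets (renewal Q0) = sets path_F" "sets (renewal (return borel ebar)) = sets path_F"
  using renewal_in_prob_algebra[OF Q0] renewal_in_prob_algebra[OF return_in_prob_algebra, of ebar]
  by (simp_all add: space_prob_algebra)

lemma prob_space_renewal: "prob_space (renewal Q0)" "prob_space (renewal (return borel ebar))"
  using renewal_in_prob_algebra[OF Q0] renewal_in_prob_algebra[OF return_in_prob_algebra, of ebar]
  by (simp_all add: space_prob_algebra)

sublocale noise: sequence_space "renewal Q0 \<Otimes>\<^sub>M renewal (return borel ebar)"
proof -
  interpret prob_space "renewal Q0 \<Otimes>\<^sub>M renewal (return borel ebar)"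
    by (intro prob_space_pair prob_space_renewal)
  show "sequence_space (renewal Q0 \<Otimes>\<^sub>M renewal (return borel ebar))"
    by unfold_locales
qed

lemma prob_space_noise: "prob_space noise"
  unfolding noise_def by (rule noise.P.prob_space_axioms)

lemma sets_noise [measurable_cong]: "sets noise = sets (\<Pi>\<^sub>M k\<in>UNIV. path_F \<Otimes>\<^sub>M path_F)"
  unfolding noise_def by (intro sets_PiM_cong sets_pair_measure_cong refl sets_renewal)

lemma measurable_fresh [measurable]: "(\<lambda>p. fresh (fst p) (snd p) k) \<in> path_F \<Otimes>\<^sub>M noise \<rightarrow>\<^sub>M path_F"
  by (cases k) (simp_all, measurable)

lemma measurable_realize [measurable]:
  "(\<lambda>p. realize (fst p) (fst (snd p)) (snd (snd p))) \<in> borel \<Otimes>\<^sub>M (path_F \<Otimes>\<^sub>M noise) \<rightarrow>\<^sub>M seq_space"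
  unfolding realize_def seq_space_def
proof (rule measurable_Pair)
  let ?N = "borel \<Otimes>\<^sub>M (path_F \<Otimes>\<^sub>M noise)"
  let ?f = "\<lambda>p k. if \<forall>j<k. \<sigma> (fresh (fst (snd p)) (snd (snd p)) j) < \<infinity>
    then fresh (fst (snd p)) (snd (snd p)) k else snd (snd (snd p) (k - 1))"
  have fresh [measurable]: "(\<lambda>p. fresh (fst (snd p)) (snd (snd p)) k) \<in> ?N \<rightarrow>\<^sub>M path_F" for k
    by (rule measurable_compose[OF measurable_snd measurable_fresh])
  have m: "(\<lambda>p. ?f p k) \<in> ?N \<rightarrow>\<^sub>M path_F" for k
    by measurable
  show "?f \<in> ?N \<rightarrow>\<^sub>M (\<Pi>\<^sub>M k\<in>UNIV. path_F)"
  proof (rule measurable_PiM_single'[OF m])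
    show "?f \<in> space ?N \<rightarrow> (UNIV \<rightarrow>\<^sub>E space path_F)"
      using measurable_space[OF m] by (auto simp: PiE_UNIV_domain simp del: space_path_algebra)
  qed
qed measurable

lemma measurable_realize_fixed [measurable]:
  "(\<lambda>p. realize x (fst p) (snd p)) \<in> path_F \<Otimes>\<^sub>M noise \<rightarrow>\<^sub>M seq_space"
  using measurable_compose[OF measurable_Pair1' measurable_realize] by simp

text \<open>A spare path appears only after an infinite fresh lifetime, and the first such lifetime
  is itself realized, so both tests fail together.\<close>

lemma realize_finite_iff:
  "(\<forall>j<k. \<sigma> (snd (realize x \<omega> s) j) < \<infinity>) \<longleftrightarrow> (\<forall>j<k. \<sigma> (fresh \<omega> s j) < \<infinity>)"
proof (induction k)
  case (Suc k)
  have "snd (realize x \<omega> s) k = fresh \<omega> s k" if "\<forall>j<k. \<sigma> (fresh \<omega> s j) < \<infinity>"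
    using that by (simp add: realize_def)
  then show ?case
    unfolding All_less_Suc using Suc by metis
qed simp

text \<open>The history up to \<open>k\<close> uses noise entries below \<open>k\<close> only, which
  makes entry \<open>k\<close> independent of it.\<close>

lemma hist_realize_cong:
  assumes "\<And>j. j < k \<Longrightarrow> s j = s' j"
  shows "hist k (realize x \<omega> s) = hist k (realize x \<omega> s')"
proof -
  have fresh: "fresh \<omega> s j = fresh \<omega> s' j" if "j \<le> k" for j
    using assms that by (cases j) auto
  have "snd (realize x \<omega> s) i = snd (realize x \<omega> s') i" if i: "i \<le> k" for i
  proof (cases i)
    case (Suc j)
    then show ?thesis
      using fresh i assms[of j] by (auto simp: realize_def)
  qed (simp add: realize_def)
  then show ?thesis
    by (auto simp: hist_def realize_def)
qed

abbreviation kernel :: "nat \<Rightarrow> 'e seqs \<Rightarrow> 'e path measure" where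
  "kernel \<equiv> step_kernel P Q ebar \<tau> Z"

definition all_finite :: "nat \<Rightarrow> 'e seqs \<Rightarrow> bool" where
  "all_finite k h \<longleftrightarrow> (\<forall>j\<le>k. \<sigma> (snd h j) < \<infinity>)"

lemma kernel_eq:
  assumes "h \<in> space (hist_space k)"
  shows "kernel k h =
    (if all_finite k h then renewal Q0 else renewal (return borel ebar))"
proof -
  have "snd h i \<in> cadlag" if "i \<le> k" for i
    using assms that by (auto simp: space_hist_space)
  then have "impulse_law Q ebar \<tau> Z k h =
      (if (\<Sum>j\<le>k. \<sigma> (snd h j)) < \<infinity> then Q0 else return borel ebar)"
    by (rule impulse_law_eq)
  moreover have "(\<Sum>j\<le>k. \<sigma> (snd h j)) < \<infinity> \<longleftrightarrow> all_finite k h"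
    by (auto simp: all_finite_def)
  ultimately show ?thesis
    unfolding step_kernel_def renewal_def by auto
qed

lemma pred_all_finite [measurable]: "Measurable.pred (hist_space k) (all_finite k)"
proof -
  have [measurable]: "(\<lambda>h. \<Sum>j\<le>k. \<sigma> (snd h j)) \<in> borel_measurable (hist_space k)"
    by (intro borel_measurable_sum measurable_compose[OF measurable_snd_hist_space measurable_\<sigma>]) simp
  have "Measurable.pred (hist_space k) (\<lambda>h. (\<Sum>j\<le>k. \<sigma> (snd h j)) < \<infinity>)"
    by measurable
  moreover have "(\<Sum>j\<le>k. \<sigma> (snd h j)) < \<infinity> \<longleftrightarrow> all_finite k h" for h :: "'e seqs"
    by (auto simp: all_finite_def)
  ultimately show ?thesis
    by (simp only:)
qed

text \<open>\<open>P\<close> is measurable only after completion, but the kernel has just two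
  values, separated by a measurable condition on the history. This is the assumption of
  \<open>has_kernels_unique\<close>.\<close>

lemma measurable_kernel:
  "F \<in> sets path_F \<Longrightarrow> (\<lambda>h. emeasure (kernel k h) F) \<in> borel_measurable (hist_space k)"
proof -
  have "(\<lambda>h. emeasure (kernel k h) F) \<in> borel_measurable (hist_space k) \<longleftrightarrow>
      (\<lambda>h. if all_finite k h then emeasure (renewal Q0) F
        else emeasure (renewal (return borel ebar)) F) \<in> borel_measurable (hist_space k)"
    by (intro measurable_cong) (simp add: kernel_eq)
  moreover have "(\<lambda>h. if all_finite k h then emeasure (renewal Q0) F
      else emeasure (renewal (return borel ebar)) F) \<in> borel_measurable (hist_space k)"
    by measurable
  ultimately show ?thesis
    by simp
qed

definition sample_law :: "'e \<Rightarrow> ('e path \<times> (nat \<Rightarrow> 'e path \<times> 'e path)) measure" where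
  "sample_law x = P x \<Otimes>\<^sub>M noise"

lemma sets_sample_law [measurable_cong]: "sets (sample_law x) = sets (path_F \<Otimes>\<^sub>M noise)"
  unfolding sample_law_def by (intro sets_pair_measure_cong refl sets_P)

lemma prob_space_sample_law: "prob_space (sample_law x)"
  unfolding sample_law_def by (intro prob_space_pair prob_space_P prob_space_noise)

lemma nn_integral_sample_law:
  assumes "f \<in> borel_measurable (path_F \<Otimes>\<^sub>M noise)"
  shows "(\<integral>\<^sup>+p. f p \<partial>sample_law x) = (\<integral>\<^sup>+\<omega>. \<integral>\<^sup>+s. f (\<omega>, s) \<partial>noise \<partial>P x)"
proof -
  interpret N: prob_space noise
    by (rule prob_space_noise)
  have "f \<in> borel_measurable (P x \<Otimes>\<^sub>M noise)"
    using assms by (simp cong: measurable_cong_sets add: sets_P)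
  then show ?thesis
    unfolding sample_law_def by (rule N.nn_integral_fst[symmetric])
qed

text \<open>Entry \<open>k\<close> is independent of the history \<open>h\<close>, and the history
  selects which of its two components is used. Integrating that component out produces the
  kernel.\<close>

lemma nn_integral_noise_step:
  assumes h [measurable]: "h \<in> noise \<rightarrow>\<^sub>M hist_space k"
    and dep: "\<And>s s'. (\<And>j. j < k \<Longrightarrow> s j = s' j) \<Longrightarrow> h s = h s'"
    and A [measurable]: "A \<in> sets (hist_space k)" and F [measurable]: "F \<in> sets path_F"
  shows "(\<integral>\<^sup>+s. indicator A (h s) *
      indicator F (if all_finite k (h s) then fst (s k) else snd (s k)) \<partial>noise) =
    (\<integral>\<^sup>+s. indicator A (h s) * emeasure (kernel k (h s)) F \<partial>noise)"
proof -
  let ?M = "renewal Q0 \<Otimes>\<^sub>M renewal (return borel ebar)"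
  define g :: "_ \<Rightarrow> _ \<Rightarrow> ennreal" where
    "g s a = indicator A (h s) * indicator F (if all_finite k (h s) then fst a else snd a)" for s a
  have M: "sets ?M = sets (path_F \<Otimes>\<^sub>M path_F)"
    by (intro sets_pair_measure_cong sets_renewal)
  have "case_prod g \<in> borel_measurable (noise \<Otimes>\<^sub>M (path_F \<Otimes>\<^sub>M path_F))"
    unfolding g_def case_prod_beta by measurable
  then have g: "case_prod g \<in> borel_measurable (noise \<Otimes>\<^sub>M ?M)"
    by (simp cong: measurable_cong_sets add: sets_pair_measure_cong[OF refl M])
  have "(\<integral>\<^sup>+s. g s (s k) \<partial>noise) = (\<integral>\<^sup>+s. \<integral>\<^sup>+a. g s a \<partial>?M \<partial>noise)"
    unfolding noise_def
  proof (rule noise.nn_integral_fresh_coordinate)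
    show "case_prod g \<in> borel_measurable (noise.S \<Otimes>\<^sub>M ?M)"
      using g by (simp add: noise_def)
    show "g s a = g s' a" if "\<And>j. j < k \<Longrightarrow> s j = s' j" for s s' a
      using dep[OF that] by (simp add: g_def)
  qed
  also have "\<dots> = (\<integral>\<^sup>+s. indicator A (h s) * emeasure (kernel k (h s)) F \<partial>noise)"
  proof (rule nn_integral_cong)
    fix s assume s: "s \<in> space noise"
    interpret R: prob_space "renewal Q0" by (rule prob_space_renewal)
    interpret I: prob_space "renewal (return borel ebar)" by (rule prob_space_renewal)
    have "(\<integral>\<^sup>+a. g s a \<partial>?M) = indicator A (h s) *
        (\<integral>\<^sup>+a. indicator F (if all_finite k (h s) then fst a else snd a) \<partial>?M)"
      unfolding g_def by (rule nn_integral_cmult) measurable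
    \<comment> \<open>Only the selected component is tested; the other one contributes a factor of
      mass one.\<close>
    also have "(\<integral>\<^sup>+a. indicator F (if all_finite k (h s) then fst a else snd a) \<partial>?M) =
        (\<integral>\<^sup>+a. indicator (if all_finite k (h s) then F \<times> cadlag else cadlag \<times> F) a \<partial>?M)"
    proof (rule nn_integral_cong)
      fix a assume "a \<in> space ?M"
      then have "fst a \<in> cadlag" "snd a \<in> cadlag"
        unfolding sets_eq_imp_space_eq[OF M] by (auto simp: space_pair_measure)
      then show "(indicator F (if all_finite k (h s) then fst a else snd a) :: ennreal) =
          indicator (if all_finite k (h s) then F \<times> cadlag else cadlag \<times> F) a"
        by (auto simp: indicator_def mem_Times_iff)
    qed
    also have "\<dots> = emeasure ?M (if all_finite k (h s) then F \<times> cadlag else cadlag \<times> F)"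
      using sets.top[of path_F] by (intro nn_integral_indicator) (auto simp: M)
    also have "\<dots> = emeasure (kernel k (h s)) F"
    proof -
      have "emeasure ?M (A \<times> B) = emeasure (renewal Q0) A * emeasure (renewal (return borel ebar)) B"
        if "A \<in> sets path_F" "B \<in> sets path_F" for A B
        using that by (intro I.emeasure_pair_measure_Times) (simp_all add: sets_renewal)
      then show ?thesis
        using sets.top[of "path_F :: 'e path measure"] R.emeasure_space_1 I.emeasure_space_1
        by (simp add: kernel_eq[OF measurable_space[OF h s]] F sets_renewal[THEN sets_eq_imp_space_eq])
    qed
    finally show "(\<integral>\<^sup>+a. g s a \<partial>?M) = indicator A (h s) * emeasure (kernel k (h s)) F" .
  qed
  finally show ?thesis
    by (simp add: g_def)
qed

lemma realize_law_has_kernels: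
  "has_kernels (aug_law P x) kernel (distr (sample_law x) seq_space (\<lambda>p. realize x (fst p) (snd p)))"
  (is "has_kernels _ _ ?M")
proof -
  interpret prob_space "sample_law x"
    by (rule prob_space_sample_law)
  interpret N: prob_space noise
    by (rule prob_space_noise)
  let ?r = "\<lambda>p. realize x (fst p) (snd p)"
  have r [measurable]: "?r \<in> sample_law x \<rightarrow>\<^sub>M seq_space"
    by measurable
  have "prob_space ?M"
    by (rule prob_space_distr) (rule r)
  then have 1: "?M \<in> space (prob_algebra seq_space)"
    by (simp add: space_prob_algebra)
  have a [measurable]: "(\<lambda>w. (fst w, snd w 0)) \<in> seq_space \<rightarrow>\<^sub>M aug"
    unfolding aug_def by measurable
  have x [measurable]: "(\<lambda>\<omega>. (x, \<omega>)) \<in> P x \<rightarrow>\<^sub>M aug"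
    unfolding aug_def by measurable
  have f: "fst \<in> sample_law x \<rightarrow>\<^sub>M P x"
    by (simp add: sample_law_def)
  have "distr ?M aug (\<lambda>w. (fst w, snd w 0)) = distr (sample_law x) aug (\<lambda>p. (x, fst p))"
    by (subst distr_distr[OF a r]) (simp add: comp_def realize_def)
  also have "\<dots> = distr (distr (sample_law x) (P x) fst) aug (\<lambda>\<omega>. (x, \<omega>))"
    by (subst distr_distr[OF x f]) (simp add: comp_def)
  also have "distr (sample_law x) (P x) fst = P x"
    unfolding sample_law_def by (rule N.distr_pair_fst)
  finally have 2: "distr ?M aug (\<lambda>w. (fst w, snd w 0)) = aug_law P x"
    by (simp add: aug_law_def)
  have 3: "emeasure ?M {w \<in> space seq_space. hist k w \<in> A \<and> snd w (Suc k) \<in> F} =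
      (\<integral>\<^sup>+w. indicator A (hist k w) * emeasure (kernel k (hist k w)) F \<partial>completion ?M)"
    if A [measurable]: "A \<in> sets (hist_space k)" and F [measurable]: "F \<in> sets path_F" for k A F
  proof -
    note measurable_kernel[OF F, measurable]
    define h where "h \<omega> s = hist k (realize x \<omega> s)" for \<omega> s
    have h [measurable]: "(\<lambda>p. h (fst p) (snd p)) \<in> path_F \<Otimes>\<^sub>M noise \<rightarrow>\<^sub>M hist_space k"
      unfolding h_def by measurable
    \<comment> \<open>\<open>realize\<close> decides by the fresh paths, the kernel by the realized
      history; \<open>realize_finite_iff\<close> identifies the two tests.\<close>
    have snd_Suc: "snd (realize x \<omega> s) (Suc k) =
        (if all_finite k (h \<omega> s) then fst (s k) else snd (s k))" for \<omega> s
      using realize_finite_iff[of "Suc k" x \<omega> s]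
      by (auto simp: realize_def h_def hist_def less_Suc_eq_le all_finite_def)
    let ?X = "{w \<in> space seq_space. hist k w \<in> A \<and> snd w (Suc k) \<in> F}"
    have X [measurable]: "?X \<in> sets seq_space"
      by measurable
    have "emeasure ?M ?X = (\<integral>\<^sup>+w. indicator ?X w \<partial>?M)"
      by simp
    also have "\<dots> = (\<integral>\<^sup>+w. indicator A (hist k w) * indicator F (snd w (Suc k)) \<partial>?M)"
      by (intro nn_integral_cong) (auto simp: indicator_def)
    also have "\<dots> = (\<integral>\<^sup>+p. indicator A (hist k (?r p)) * indicator F (snd (?r p) (Suc k)) \<partial>sample_law x)"
      by (rule nn_integral_distr) measurable
    also have "\<dots> = (\<integral>\<^sup>+\<omega>. \<integral>\<^sup>+s. indicator A (h \<omega> s) *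
        indicator F (if all_finite k (h \<omega> s) then fst (s k) else snd (s k)) \<partial>noise \<partial>P x)"
      by (subst nn_integral_sample_law) (measurable, simp add: snd_Suc h_def)
    also have "\<dots> = (\<integral>\<^sup>+\<omega>. \<integral>\<^sup>+s. indicator A (h \<omega> s) * emeasure (kernel k (h \<omega> s)) F \<partial>noise \<partial>P x)"
    proof (rule nn_integral_cong)
      fix \<omega> assume "\<omega> \<in> space (P x)"
      then have "\<omega> \<in> space path_F"
        by (simp add: sets_eq_imp_space_eq[OF sets_P])
      then have "h \<omega> \<in> noise \<rightarrow>\<^sub>M hist_space k"
        using measurable_compose[OF measurable_Pair1' h] by simp
      moreover have "h \<omega> s = h \<omega> s'" if "\<And>j. j < k \<Longrightarrow> s j = s' j" for s s'
        unfolding h_def using that by (rule hist_realize_cong)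
      ultimately show "(\<integral>\<^sup>+s. indicator A (h \<omega> s) *
          indicator F (if all_finite k (h \<omega> s) then fst (s k) else snd (s k)) \<partial>noise) =
          (\<integral>\<^sup>+s. indicator A (h \<omega> s) * emeasure (kernel k (h \<omega> s)) F \<partial>noise)"
        by (rule nn_integral_noise_step[OF _ _ A F])
    qed
    also have "\<dots> = (\<integral>\<^sup>+p. indicator A (hist k (?r p)) * emeasure (kernel k (hist k (?r p))) F \<partial>sample_law x)"
      by (subst nn_integral_sample_law) (measurable, simp add: h_def)
    also have "\<dots> = (\<integral>\<^sup>+w. indicator A (hist k w) * emeasure (kernel k (hist k w)) F \<partial>?M)"
      by (rule nn_integral_distr[symmetric]) measurable
    finally show ?thesis
      by (simp add: nn_integral_completion)
  qed
  show ?thesis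
    unfolding has_kernels_def using 1 2 3 by blast
qed

lemma seq_law_eq: "seq_law P Q ebar \<tau> Z x = distr (sample_law x) seq_space (\<lambda>p. realize x (fst p) (snd p))"
  unfolding seq_law_def
proof (rule the_equality)
  fix M assume "has_kernels (aug_law P x) kernel M"
  then show "M = distr (sample_law x) seq_space (\<lambda>p. realize x (fst p) (snd p))"
    using realize_law_has_kernels measurable_kernel by (rule has_kernels_unique)
qed (rule realize_law_has_kernels)

lemma ctrl_law_eq:
  "ctrl_law P Q ebar \<tau> Z x =
    distr (sample_law x) aug (\<lambda>p. ctrl_path ebar \<tau> (realize x (fst p) (snd p)))"
  unfolding ctrl_law_def seq_law_eq
  by (subst distr_distr[OF measurable_ctrl_path]) (simp_all add: comp_def)

end

section \<open>The law of the cycles\<close>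

lemma tendsto_zero_of_suminf_ennreal:
  fixes f :: "nat \<Rightarrow> ennreal"
  assumes "(\<Sum>k. f k) \<noteq> \<infinity>"
  shows "f \<longlonglongrightarrow> 0"
proof -
  have "f k < \<infinity>" for k
    using assms ennreal_suminf_lessD[of f \<infinity> k] by (simp add: top.not_eq_extremum)
  then have f: "ennreal (enn2real (f k)) = f k" for k
    by simp
  have "(\<Sum>k. ennreal (enn2real (f k))) \<noteq> top"
    using assms f by simp
  then have "summable (\<lambda>k. enn2real (f k))"
    by (intro summable_suminf_not_top) auto
  then have "(\<lambda>k. ennreal (enn2real (f k))) \<longlonglongrightarrow> ennreal 0"
    by (intro tendsto_ennrealI summable_LIMSEQ_zero)
  then show ?thesis
    using f by simp
qed

text \<open>Some \<open>\<epsilon> > 0\<close> is exceeded by \<open>f\<close> with positive probability, hence by infinitely many terms.\<close>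

lemma (in sequence_space) AE_suminf_eq_top:
  fixes f :: "'a \<Rightarrow> ennreal"
  assumes [measurable]: "f \<in> borel_measurable M" and pos: "\<And>a. a \<in> space M \<Longrightarrow> 0 < f a"
  shows "AE s in S. (\<Sum>k. f (s k)) = \<infinity>"
proof -
  \<comment> \<open>These sets decrease to the empty set because \<open>f\<close> is positive, so
    one of them has measure \<open>p < 1\<close>.\<close>
  let ?B = "\<lambda>n. {a \<in> space M. f a \<le> ennreal (1 / Suc n)}"
  have B [measurable]: "?B n \<in> sets M" for n
    by measurable
  have "(\<Inter>n. ?B n) = {}"
  proof -
    have "\<exists>n. \<not> f a \<le> ennreal (1 / Suc n)" if "a \<in> space M" for a
    proof -
      have "(\<lambda>n. ennreal (1 / Suc n)) \<longlonglongrightarrow> ennreal 0"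
        using LIMSEQ_inverse_real_of_nat by (intro tendsto_ennrealI) (simp add: inverse_eq_divide)
      then have "\<forall>\<^sub>F n in sequentially. ennreal (1 / Suc n) < f a"
        using pos[OF that] by (intro order_tendstoD) auto
      then show ?thesis
        by (auto simp: eventually_sequentially not_le)
    qed
    then show ?thesis
      by blast
  qed
  moreover have "decseq ?B"
  proof (rule decseq_SucI)
    fix n
    have "ennreal (1 / real (Suc (Suc n))) \<le> ennreal (1 / real (Suc n))"
      by (intro ennreal_leI divide_left_mono) auto
    then show "?B (Suc n) \<subseteq> ?B n"
      by (auto intro: order_trans)
  qed
  ultimately have "(\<lambda>n. measure M (?B n)) \<longlonglongrightarrow> 0"
    using M.finite_Lim_measure_decseq[of ?B] B by (simp add: image_subset_iff)
  then have "\<forall>\<^sub>F n in sequentially. measure M (?B n) < 1"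
    by (rule order_tendstoD) simp
  then obtain n where n: "measure M (?B n) < 1"
    by (auto simp: eventually_sequentially)
  define p where "p = measure M (?B n)"
  have p: "0 \<le> p" "p < 1"
    using n by (auto simp: p_def)
  \<comment> \<open>Staying in \<open>?B n\<close> for \<open>l\<close> consecutive terms has
    probability \<open>p ^ l\<close>; letting \<open>l\<close> grow, staying there forever has
    probability zero.\<close>
  have "AE s in S. \<not> (\<forall>i\<ge>m. s i \<in> ?B n)" for m
  proof -
    let ?N = "{s \<in> space S. \<forall>i\<ge>m. s i \<in> ?B n}"
    have [measurable]: "?N \<in> sets S"
    proof -
      have "?N = (\<Inter>i\<in>{m..}. (\<lambda>s. s i) -` ?B n \<inter> space S)"
        by auto
      also have "\<dots> \<in> sets S"
        by (intro sets.countable_INT' measurable_sets[OF measurable_component_singleton]) auto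
      finally show ?thesis .
    qed
    have le: "measure S ?N \<le> p ^ l" for l
    proof -
      have [measurable]: "{s \<in> space S. \<forall>i\<in>{m..<m + l}. s i \<in> ?B n} \<in> sets S" (is "?L \<in> _")
        by measurable
      have "emeasure S ?L = (\<Prod>i\<in>{m..<m + l}. emeasure M (?B n))"
        by (rule emeasure_PiM_Collect) (use B in auto)
      also have "\<dots> = ennreal (p ^ l)"
        by (simp add: M.emeasure_eq_measure p_def ennreal_power)
      finally have "measure S ?L = p ^ l"
        using p by (simp add: measure_def)
      moreover have "measure S ?N \<le> measure S ?L"
        by (rule P.finite_measure_mono) auto
      ultimately show ?thesis
        by simp
    qed
    have "(\<lambda>l. p ^ l) \<longlonglongrightarrow> 0"
      using p by (intro LIMSEQ_realpow_zero) auto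
    then have "measure S ?N \<le> 0"
      using le by (intro LIMSEQ_le_const) auto
    then have "emeasure S ?N = 0"
      by (simp add: P.emeasure_eq_measure measure_le_0_iff)
    then show ?thesis
      by (intro AE_I[where N = ?N]) auto
  qed
  then have "AE s in S. \<forall>m. \<not> (\<forall>i\<ge>m. s i \<in> ?B n)"
    by (simp add: AE_all_countable)
  then show ?thesis
    using AE_space
  proof eventually_elim
    case (elim s)
    show ?case
    proof (rule ccontr)
      \<comment> \<open>A finite sum has terms tending to 0, which from some index on would keep the
        sequence in \<open>?B n\<close>.\<close>
      assume "(\<Sum>k. f (s k)) \<noteq> \<infinity>"
      then have "(\<lambda>k. f (s k)) \<longlonglongrightarrow> 0"
        by (rule tendsto_zero_of_suminf_ennreal)
      then have "\<forall>\<^sub>F k in sequentially. f (s k) < ennreal (1 / Suc n)"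
        by (rule order_tendstoD) simp
      then obtain m where "\<And>i. i \<ge> m \<Longrightarrow> f (s i) < ennreal (1 / Suc n)"
        by (auto simp: eventually_sequentially)
      then show False
        using elim by (fastforce simp: space_PiM PiE_iff intro: less_imp_le)
    qed
  qed
qed

context controlled_cycles
begin

lemma AE_noise_suminf: "AE s in noise. (\<Sum>k. \<sigma> (fst (s k))) = \<infinity>"
  unfolding noise_def
proof (rule noise.AE_suminf_eq_top)
  have sets: "sets (renewal Q0 \<Otimes>\<^sub>M renewal (return borel ebar)) = sets (path_F \<Otimes>\<^sub>M path_F)"
    by (intro sets_pair_measure_cong sets_renewal)
  show "(\<lambda>a. \<sigma> (fst a)) \<in> borel_measurable (renewal Q0 \<Otimes>\<^sub>M renewal (return borel ebar))"
    unfolding measurable_cong_sets[OF sets refl] by measurable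
  show "0 < \<sigma> (fst a)" if "a \<in> space (renewal Q0 \<Otimes>\<^sub>M renewal (return borel ebar))" for a
    using that unfolding sets_eq_imp_space_eq[OF sets] by (intro \<sigma>_pos) (auto simp: space_pair_measure)
qed

text \<open>Either all fresh lifetimes are finite, and then all fresh paths are realized and the
  noise already makes the sum diverge, or the first infinite fresh lifetime is realized and is by
  itself an infinite term.\<close>

lemma AE_realize_suminf: "AE p in sample_law x. (\<Sum>j. \<sigma> (snd (realize x (fst p) (snd p)) j)) = \<infinity>"
proof -
  interpret N: prob_space noise by (rule prob_space_noise)
  interpret Px: prob_space "P x" by (rule prob_space_P)
  interpret pair_sigma_finite "P x" noise ..
  have suminf: "(\<Sum>j. \<sigma> (snd (realize x \<omega> s) j)) = \<infinity>" if s: "(\<Sum>k. \<sigma> (fst (s k))) = \<infinity>" for \<omega> s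
  proof (cases "\<forall>j. \<sigma> (fresh \<omega> s j) < \<infinity>")
    case True
    then have "snd (realize x \<omega> s) j = fresh \<omega> s j" for j
      by (simp add: realize_def)
    moreover have "(\<Sum>j. \<sigma> (fresh \<omega> s j)) = (\<Sum>j. \<sigma> (fst (s j))) + \<sigma> \<omega>"
      using suminf_offset[of "\<lambda>j. \<sigma> (fresh \<omega> s j)" 1] by simp
    ultimately show ?thesis
      using s by simp
  next
    case False
    then obtain j where "\<not> \<sigma> (fresh \<omega> s j) < \<infinity>" "\<forall>i<j. \<sigma> (fresh \<omega> s i) < \<infinity>"
      using exists_least_iff[of "\<lambda>j. \<not> \<sigma> (fresh \<omega> s j) < \<infinity>"] by blast
    then have "\<not> \<sigma> (snd (realize x \<omega> s) j) < \<infinity>"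
      by (simp add: realize_def)
    then show ?thesis
      using ennreal_suminf_lessD[of "\<lambda>j. \<sigma> (snd (realize x \<omega> s) j)" \<infinity> j]
      by (metis infinity_ennreal_def top.not_eq_extremum)
  qed
  have [measurable]: "(\<lambda>w. \<Sum>j. \<sigma> (snd w j)) \<in> borel_measurable seq_space"
    by measurable
  have [measurable]: "Measurable.pred (sample_law x) (\<lambda>p. (\<Sum>j. \<sigma> (snd (realize x (fst p) (snd p)) j)) = \<infinity>)"
    by measurable
  then have "{p \<in> space (sample_law x). (\<Sum>j. \<sigma> (snd (realize x (fst p) (snd p)) j)) = \<infinity>} \<in> sets (sample_law x)"
    by (simp add: pred_def)
  then show ?thesis
    unfolding sample_law_def
    by (rule AE_pair_measure) (use AE_noise_suminf suminf in auto)
qed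

section \<open>Averaging over the initial point and the product formula\<close>

lemma measurable_sample_law:
  assumes "\<kappa> \<in> space (prob_algebra borel)"
  shows "sample_law \<in> completion \<kappa> \<rightarrow>\<^sub>M prob_algebra (path_F \<Otimes>\<^sub>M noise)"
  unfolding sample_law_def
proof (rule measurable_pair_prob)
  show "P \<in> completion \<kappa> \<rightarrow>\<^sub>M prob_algebra path_F"
    using assms by (rule measurable_P)
  show "(\<lambda>_. noise) \<in> completion \<kappa> \<rightarrow>\<^sub>M prob_algebra noise"
    by (rule measurable_const) (simp add: space_prob_algebra prob_space_noise)
qed

text \<open>The point \<open>x\<close> enters twice: through \<open>P x\<close>, which is measurable
  for the completion, and as the value at \<open>0-\<close>, where the dependence is Borel. This
  allows the mixture in \<open>ctrl_law_init\<close> to be evaluated.\<close>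

lemma measurable_ctrl_law:
  assumes \<kappa>: "\<kappa> \<in> space (prob_algebra borel)"
  shows "ctrl_law P Q ebar \<tau> Z \<in> completion \<kappa> \<rightarrow>\<^sub>M prob_algebra aug"
  unfolding ctrl_law_eq[abs_def]
proof (rule measurable_distr_prob_space2[OF measurable_sample_law[OF \<kappa>]])
  have [measurable_cong]: "sets \<kappa> = sets borel"
    using \<kappa> by (simp add: space_prob_algebra)
  have "(\<lambda>x. x) \<in> \<kappa> \<rightarrow>\<^sub>M borel"
    by measurable
  then have id: "(\<lambda>x. x) \<in> completion \<kappa> \<rightarrow>\<^sub>M borel"
    by (rule measurable_completion)
  have "(\<lambda>p. (fst p, snd p)) \<in> completion \<kappa> \<Otimes>\<^sub>M (path_F \<Otimes>\<^sub>M noise) \<rightarrow>\<^sub>M borel \<Otimes>\<^sub>M (path_F \<Otimes>\<^sub>M noise)"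
    by (intro measurable_Pair measurable_snd measurable_compose[OF measurable_fst id])
  from measurable_compose[OF measurable_compose[OF this measurable_realize] measurable_ctrl_path[of ebar]]
  show "(\<lambda>(x, p). ctrl_path ebar \<tau> (realize x (fst p) (snd p))) \<in> completion \<kappa> \<Otimes>\<^sub>M (path_F \<Otimes>\<^sub>M noise) \<rightarrow>\<^sub>M aug"
    by (simp add: case_prod_beta)
qed

abbreviation controlled :: "'e measure \<Rightarrow> 'e apath measure" where
  "controlled \<equiv> ctrl_law_init P Q ebar \<tau> Z"

lemma controlled_in_prob_algebra:
  assumes \<nu>: "\<nu> \<in> space (prob_algebra borel)"
  shows "controlled \<nu> \<in> space (prob_algebra aug)"
  using prob_space_bind'[OF completion_in_prob_algebra[OF \<nu>] measurable_ctrl_law[OF \<nu>]]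
    sets_bind'[OF completion_in_prob_algebra[OF \<nu>] measurable_ctrl_law[OF \<nu>]]
  by (simp add: ctrl_law_init_def space_prob_algebra)

lemma emeasure_controlled:
  assumes \<nu>: "\<nu> \<in> space (prob_algebra borel)" and "X \<in> sets aug"
  shows "emeasure (controlled \<nu>) X = (\<integral>\<^sup>+x. emeasure (ctrl_law P Q ebar \<tau> Z x) X \<partial>\<nu>)"
  unfolding ctrl_law_init_def
  using emeasure_bind_prob_algebra[OF completion_in_prob_algebra[OF \<nu>] measurable_ctrl_law[OF \<nu>] assms(2)]
  by (simp add: nn_integral_completion)

lemma emeasure_renewal:
  assumes \<nu>: "\<nu> \<in> space (prob_algebra borel)" and "F \<in> sets path_F"
  shows "emeasure (renewal \<nu>) F = (\<integral>\<^sup>+x. emeasure (P x) F \<partial>\<nu>)"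
  unfolding renewal_def
  using emeasure_bind_prob_algebra[OF completion_in_prob_algebra[OF \<nu>] measurable_P[OF \<nu>] assms(2)]
  by (simp add: nn_integral_completion)

text \<open>Finite lifetimes are asked for \<open>k < n\<close> only: together they amount to
  \<open>\<tau> n < \<infinity>\<close>, while cycle \<open>n\<close> may last forever.\<close>

definition cycle_paths :: "nat \<Rightarrow> (nat \<Rightarrow> (real \<Rightarrow> 'e option) set) \<Rightarrow> nat \<Rightarrow> 'e path set" where
  "cycle_paths n A k = {\<omega> \<in> cadlag. first_cycle \<sigma> \<omega> \<in> A k \<and> (k < n \<longrightarrow> \<sigma> \<omega> < \<infinity>)}"

text \<open>Finiteness of \<open>\<tau> n\<close> belongs to the event because it ensures that the
  cycles up to \<open>n\<close> are all copied from fresh paths.\<close>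

definition cycle_event :: "nat \<Rightarrow> (nat \<Rightarrow> (real \<Rightarrow> 'e option) set) \<Rightarrow> 'e apath set" where
  "cycle_event n A = {\<omega> \<in> space aug. \<tau> n \<omega> < \<infinity> \<and> (\<forall>k\<le>n. path_cycle \<tau> k \<omega> \<in> A k)}"

lemma sets_cycle_paths:
  assumes "A k \<in> sets cycle_space"
  shows "cycle_paths n A k \<in> sets path_F"
proof -
  have "cycle_paths n A k = (first_cycle \<sigma> -` A k \<inter> space path_F) \<inter>
      (if k < n then {\<omega> \<in> space path_F. \<sigma> \<omega> < \<infinity>} else space path_F)"
    by (auto simp: cycle_paths_def)
  also have "\<dots> \<in> sets path_F"
  proof (rule sets.Int)
    show "first_cycle \<sigma> -` A k \<inter> space path_F \<in> sets path_F"
      by (rule measurable_sets[OF measurable_first_cycle[OF measurable_\<sigma>] assms])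
    have "{\<omega> \<in> space path_F. \<sigma> \<omega> < \<infinity>} \<in> sets path_F"
      by measurable
    then show "(if k < n then {\<omega> \<in> space path_F. \<sigma> \<omega> < \<infinity>} else space path_F) \<in> sets path_F"
      using sets.top by (auto simp del: space_path_algebra)
  qed
  finally show ?thesis .
qed

lemma sets_cycle_event:
  assumes "\<And>k. k \<le> n \<Longrightarrow> A k \<in> sets cycle_space"
  shows "cycle_event n A \<in> sets aug"
proof -
  have "cycle_event n A = {\<omega> \<in> space aug. \<tau> n \<omega> < \<infinity>} \<inter> (\<Inter>k\<in>{..n}. path_cycle \<tau> k -` A k \<inter> space aug)"
    by (auto simp: cycle_event_def)
  also have "\<dots> \<in> sets aug"
    using assms by (intro sets.Int sets.finite_INT measurable_sets[OF measurable_path_cycle]) auto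
  finally show ?thesis .
qed

text \<open>If the first \<open>n\<close> fresh lifetimes are finite, the realized paths up to index
  \<open>n\<close> are the fresh ones; otherwise both sides are false. The event thus splits into
  one condition per independent path.\<close>

lemma cycle_event_iff:
  assumes \<omega>: "\<omega> \<in> cadlag" and s: "\<And>k. fst (s k) \<in> cadlag" "\<And>k. snd (s k) \<in> cadlag"
    and sum: "(\<Sum>j. \<sigma> (snd (realize x \<omega> s) j)) = \<infinity>"
  shows "ctrl_path ebar \<tau> (realize x \<omega> s) \<in> cycle_event n A \<longleftrightarrow>
    (\<forall>k\<le>n. fresh \<omega> s k \<in> cycle_paths n A k)"
proof -
  let ?w = "realize x \<omega> s"
  have f: "fresh \<omega> s k \<in> cadlag" for k
    using \<omega> s by (cases k) auto
  then have w: "snd ?w k \<in> cadlag" for k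
    using s by (simp add: realize_def)
  have lim: "(\<lambda>k. ctrl_time \<tau> k ?w) \<longlonglongrightarrow> \<infinity>"
    by (rule iffD2[OF ctrl_time_tendsto_iff[OF w] sum])
  have T: "ctrl_time \<tau> k ?w < \<infinity> \<longleftrightarrow> (\<forall>j<k. \<sigma> (fresh \<omega> s j) < \<infinity>)" for k
    unfolding realize_finite_iff[of k x, symmetric] using w by (auto simp: ctrl_time_eq_sum)
  have "path_cycle \<tau> k (ctrl_path ebar \<tau> ?w) = first_cycle \<sigma> (fresh \<omega> s k)"
    if "\<forall>j<n. \<sigma> (fresh \<omega> s j) < \<infinity>" "k \<le> n" for k
  proof -
    have k: "\<forall>j<k. \<sigma> (fresh \<omega> s j) < \<infinity>"
      using that by auto
    then have "snd ?w k = fresh \<omega> s k"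
      by (simp add: realize_def)
    then show ?thesis
      using path_cycle_ctrl_path[OF w lim, of k] T[of k] k by simp
  qed
  moreover have "ctrl_path ebar \<tau> ?w \<in> space aug"
    using w by (rule ctrl_path_in_space_aug)
  ultimately show ?thesis
    unfolding cycle_event_def cycle_paths_def mem_Collect_eq \<tau>_ctrl_path[OF w lim] T
    using f by auto
qed

text \<open>Off a null set the event is a rectangle of the sample space, with one side for the
  initial path and one for each of the first \<open>n\<close> noise entries.\<close>

lemma emeasure_ctrl_law_cycle_event:
  assumes A: "\<And>k. k \<le> n \<Longrightarrow> A k \<in> sets cycle_space"
  shows "emeasure (ctrl_law P Q ebar \<tau> Z x) (cycle_event n A) =
    emeasure (P x) (cycle_paths n A 0) * (\<Prod>k=1..n. emeasure (renewal Q0) (cycle_paths n A k))"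
proof -
  interpret N: prob_space noise by (rule prob_space_noise)
  interpret I: prob_space "renewal (return borel ebar)" by (rule prob_space_renewal)
  let ?E = "cycle_paths n A"
  have E: "?E k \<in> sets path_F" if "k \<le> n" for k
    using A that by (intro sets_cycle_paths)
  let ?c = "\<lambda>p. ctrl_path ebar \<tau> (realize x (fst p) (snd p))"
  have c [measurable]: "?c \<in> sample_law x \<rightarrow>\<^sub>M aug"
    by measurable
  \<comment> \<open>Entry \<open>k\<close> drives cycle \<open>k + 1\<close>, hence
    \<open>Suc k\<close>; the spare component is unrestricted.\<close>
  let ?S = "{s \<in> space noise. \<forall>k\<in>{..<n}. s k \<in> ?E (Suc k) \<times> cadlag}"
  have M: "sets (renewal Q0 \<Otimes>\<^sub>M renewal (return borel ebar)) = sets (path_F \<Otimes>\<^sub>M path_F)"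
    by (intro sets_pair_measure_cong sets_renewal)
  have top: "cadlag \<in> sets (path_F :: 'e path measure)"
    using sets.top[of "path_F :: 'e path measure"] by simp
  have EM: "?E (Suc k) \<times> cadlag \<in> sets (renewal Q0 \<Otimes>\<^sub>M renewal (return borel ebar))" if "k < n" for k
    unfolding M using E[of "Suc k"] that top by (intro pair_measureI) auto
  have S: "?S \<in> sets noise"
  proof -
    have "?S = (\<Inter>k\<in>{..<n}. (\<lambda>s. s k) -` (?E (Suc k) \<times> cadlag) \<inter> space noise) \<inter> space noise"
      by auto
    also have "\<dots> \<in> sets noise"
    proof (cases "n = 0")
      case False
      then show ?thesis
        unfolding noise_def
        by (intro sets.Int sets.finite_INT measurable_sets[OF measurable_component_singleton])
          (use EM in auto)
    qed simp
    finally show ?thesis .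
  qed
  have space: "space (sample_law x) = cadlag \<times> space noise"
    unfolding sets_eq_imp_space_eq[OF sets_sample_law] by (simp add: space_pair_measure)
  have "emeasure (ctrl_law P Q ebar \<tau> Z x) (cycle_event n A) =
      emeasure (sample_law x) (?c -` cycle_event n A \<inter> space (sample_law x))"
    unfolding ctrl_law_eq by (rule emeasure_distr[OF c sets_cycle_event[OF A]])
  also have "\<dots> = emeasure (sample_law x) (?E 0 \<times> ?S)"
  proof (rule emeasure_eq_AE)
    show "AE p in sample_law x. p \<in> ?c -` cycle_event n A \<inter> space (sample_law x) \<longleftrightarrow> p \<in> ?E 0 \<times> ?S"
      using AE_realize_suminf[of x] AE_space
    proof eventually_elim
      case (elim p)
      obtain \<omega> s where p: "p = (\<omega>, s)"
        by (cases p)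
      have \<omega>: "\<omega> \<in> cadlag" and s: "s \<in> space noise"
        using elim(2) by (auto simp: space p)
      have sk: "fst (s k) \<in> cadlag" "snd (s k) \<in> cadlag" for k
      proof -
        have "s k \<in> space (renewal Q0 \<Otimes>\<^sub>M renewal (return borel ebar))"
          using s by (auto simp: noise_def space_PiM)
        then show "fst (s k) \<in> cadlag" "snd (s k) \<in> cadlag"
          unfolding sets_eq_imp_space_eq[OF M] by (auto simp: space_pair_measure)
      qed
      have "?c p \<in> cycle_event n A \<longleftrightarrow> (\<forall>k\<le>n. fresh \<omega> s k \<in> ?E k)"
        using cycle_event_iff[where \<omega> = \<omega> and s = s and x = x and n = n and A = A, OF \<omega> sk] elim(1)
        by (simp add: p)
      also have "\<dots> \<longleftrightarrow> \<omega> \<in> ?E 0 \<and> (\<forall>k<n. fst (s k) \<in> ?E (Suc k))"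
        using All_less_Suc2[where n = n and P = "\<lambda>k. fresh \<omega> s k \<in> ?E k"] by (simp add: less_Suc_eq_le)
      also have "\<dots> \<longleftrightarrow> p \<in> ?E 0 \<times> ?S"
        using s sk by (auto simp: p mem_Times_iff)
      finally show ?case
        using elim(2) by simp
    qed
    show "?c -` cycle_event n A \<inter> space (sample_law x) \<in> sets (sample_law x)"
      by (rule measurable_sets[OF c sets_cycle_event[OF A]])
    show "?E 0 \<times> ?S \<in> sets (sample_law x)"
      unfolding sets_sample_law using E[of 0] S by (intro pair_measureI) auto
  qed
  also have "\<dots> = emeasure (P x) (?E 0) * emeasure noise ?S"
    unfolding sample_law_def using E[of 0] S by (intro N.emeasure_pair_measure_Times) (simp_all add: sets_P)
  also have "emeasure noise ?S =
      (\<Prod>k<n. emeasure (renewal Q0 \<Otimes>\<^sub>M renewal (return borel ebar)) (?E (Suc k) \<times> cadlag))"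
    unfolding noise_def by (rule noise.emeasure_PiM_Collect) (use EM in auto)
  also have "\<dots> = (\<Prod>k<n. emeasure (renewal Q0) (?E (Suc k)))"
  proof (rule prod.cong[OF refl])
    fix k assume "k \<in> {..<n}"
    then have "emeasure (renewal Q0 \<Otimes>\<^sub>M renewal (return borel ebar)) (?E (Suc k) \<times> cadlag) =
        emeasure (renewal Q0) (?E (Suc k)) * emeasure (renewal (return borel ebar)) cadlag"
      using E[of "Suc k"] top by (intro I.emeasure_pair_measure_Times) (simp_all add: sets_renewal)
    then show "emeasure (renewal Q0 \<Otimes>\<^sub>M renewal (return borel ebar)) (?E (Suc k) \<times> cadlag) =
        emeasure (renewal Q0) (?E (Suc k))"
      using I.emeasure_space_1 by (simp add: sets_renewal[THEN sets_eq_imp_space_eq])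
  qed
  also have "\<dots> = (\<Prod>k=1..n. emeasure (renewal Q0) (?E k))"
    by (rule prod.reindex_bij_witness[of _ "\<lambda>k. k - 1" Suc]) auto
  finally show ?thesis .
qed

definition cycle_init :: "'e measure \<Rightarrow> nat \<Rightarrow> 'e path measure" where
  "cycle_init \<nu> k = renewal (if k = 0 then \<nu> else Q0)"

lemma cycle_init_in_prob_algebra:
  "\<nu> \<in> space (prob_algebra borel) \<Longrightarrow> cycle_init \<nu> k \<in> space (prob_algebra path_F)"
  using Q0 by (simp add: cycle_init_def renewal_in_prob_algebra)

text \<open>Only the factor of cycle 0 depends on the initial point, so the average over
  \<open>\<nu>\<close> passes to this factor and the product form survives.\<close>

lemma emeasure_cycle_event:
  assumes \<nu>: "\<nu> \<in> space (prob_algebra borel)" and A: "\<And>k. k \<le> n \<Longrightarrow> A k \<in> sets cycle_space"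
  shows "emeasure (controlled \<nu>) (cycle_event n A) =
    (\<Prod>k\<le>n. emeasure (cycle_init \<nu> k) (cycle_paths n A k))"
proof -
  let ?r = "\<Prod>k=1..n. emeasure (renewal Q0) (cycle_paths n A k)"
  have E: "cycle_paths n A 0 \<in> sets path_F"
    using A by (intro sets_cycle_paths) simp
  have "(\<lambda>x. emeasure (P x) (cycle_paths n A 0)) \<in> borel_measurable (completion \<nu>)"
    using measurable_P[OF \<nu>] E
    by (intro measurable_compose[OF measurable_prob_algebraD measurable_emeasure_subprob_algebra])
  then have "(\<integral>\<^sup>+x. emeasure (P x) (cycle_paths n A 0) * ?r \<partial>completion \<nu>) =
      (\<integral>\<^sup>+x. emeasure (P x) (cycle_paths n A 0) \<partial>completion \<nu>) * ?r"
    by (rule nn_integral_multc)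
  then have "emeasure (controlled \<nu>) (cycle_event n A) = emeasure (renewal \<nu>) (cycle_paths n A 0) * ?r"
    by (simp add: emeasure_controlled[OF \<nu> sets_cycle_event[OF A]] emeasure_ctrl_law_cycle_event[OF A]
      emeasure_renewal[OF \<nu> E] nn_integral_completion)
  also have "{..n} = insert 0 {1..n}"
    by auto
  then have "emeasure (renewal \<nu>) (cycle_paths n A 0) * ?r =
      (\<Prod>k\<le>n. emeasure (cycle_init \<nu> k) (cycle_paths n A k))"
    by (simp add: cycle_init_def)
  finally show ?thesis .
qed

end

section \<open>Conditioning on the start of a cycle\<close>

lemma uniform_measure_almost_all:
  assumes "prob_space M" "A \<in> sets M" "emeasure M A = 1"
  shows "uniform_measure M A = M"
proof (rule measure_eqI)
  fix X assume "X \<in> sets (uniform_measure M A)"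
  then have X: "X \<in> sets M"
    by simp
  interpret prob_space M by fact
  have "AE x in M. x \<in> A"
    using assms by (simp add: emeasure_eq_measure prob_eq_1)
  then have "emeasure M (A \<inter> X) = emeasure M X"
    using X assms(2) by (intro emeasure_eq_AE) auto
  then show "emeasure (uniform_measure M A) X = emeasure M X"
    using X assms by (simp add: divide_ennreal_def)
qed simp

context controlled_cycles
begin

context
  fixes \<nu> :: "'e measure"
  assumes \<nu>: "\<nu> \<in> space (prob_algebra borel)"
begin

lemma sets_controlled [measurable_cong]: "sets (controlled \<nu>) = sets aug"
  using controlled_in_prob_algebra[OF \<nu>] by (simp add: space_prob_algebra)

lemma space_controlled: "space (controlled \<nu>) = space aug"
  by (rule sets_eq_imp_space_eq[OF sets_controlled])

lemma prob_space_controlled: "prob_space (controlled \<nu>)"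
  using controlled_in_prob_algebra[OF \<nu>] by (simp add: space_prob_algebra)

lemma prob_space_cycle_init: "prob_space (cycle_init \<nu> k)"
  using cycle_init_in_prob_algebra[OF \<nu>] by (simp add: space_prob_algebra)

lemma sets_started: "{\<omega> \<in> space (controlled \<nu>). \<tau> n \<omega> < \<infinity>} \<in> sets (controlled \<nu>)"
  by measurable

text \<open>The factor of cycle \<open>k\<close> in the product formula, before normalization. A
  constant family suffices because \<open>cycle_paths n A k\<close> uses only
  \<open>A k\<close>.\<close>

abbreviation weight :: "nat \<Rightarrow> nat \<Rightarrow> (real \<Rightarrow> 'e option) set \<Rightarrow> real" where
  "weight n k B \<equiv> measure (cycle_init \<nu> k) (cycle_paths n (\<lambda>_. B) k)"

lemma measure_cycle_event:
  assumes "\<And>k. k \<le> n \<Longrightarrow> A k \<in> sets cycle_space"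
  shows "measure (controlled \<nu>) (cycle_event n A) = (\<Prod>k\<le>n. weight n k (A k))"
proof -
  have "emeasure (cycle_init \<nu> k) F = ennreal (measure (cycle_init \<nu> k) F)" for k F
    using prob_space_cycle_init[of k] by (simp add: prob_space_def finite_measure.emeasure_eq_measure)
  then have "emeasure (controlled \<nu>) (cycle_event n A) =
      ennreal (\<Prod>k\<le>n. measure (cycle_init \<nu> k) (cycle_paths n A k))"
    using emeasure_cycle_event[OF \<nu> assms] by (simp add: prod_ennreal)
  also have "(\<Prod>k\<le>n. measure (cycle_init \<nu> k) (cycle_paths n A k)) = (\<Prod>k\<le>n. weight n k (A k))"
    by (simp add: cycle_paths_def)
  finally show ?thesis
    by (simp add: measure_def prod_nonneg)
qed

lemma path_cycle_in_space: "\<omega> \<in> space aug \<Longrightarrow> path_cycle \<tau> k \<omega> \<in> space cycle_space"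
  by (rule measurable_space[OF measurable_path_cycle])

text \<open>Leaving all cycles free makes the normalizing constant an instance of the same product
  formula.\<close>

lemma started_eq: "{\<omega> \<in> space (controlled \<nu>). \<tau> n \<omega> < \<infinity>} = cycle_event n (\<lambda>_. space cycle_space)"
  using path_cycle_in_space by (auto simp: cycle_event_def space_controlled)

context
  fixes n :: nat
  assumes pos: "emeasure (controlled \<nu>) {\<omega> \<in> space (controlled \<nu>). \<tau> n \<omega> < \<infinity>} > 0"
begin

abbreviation conditioned :: "'e apath measure" where
  "conditioned \<equiv> given_started \<tau> n (controlled \<nu>)"

lemma prob_space_conditioned: "prob_space conditioned"
proof -
  interpret prob_space "controlled \<nu>" by (rule prob_space_controlled)
  show ?thesis
    unfolding given_started_def using pos by (intro prob_space_uniform_measure) auto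
qed

lemma weight_space_nonzero:
  assumes "k \<le> n"
  shows "weight n k (space cycle_space) \<noteq> 0"
proof -
  interpret prob_space "controlled \<nu>" by (rule prob_space_controlled)
  have "measure (controlled \<nu>) (cycle_event n (\<lambda>_. space cycle_space)) \<noteq> 0"
    using pos unfolding started_eq by (simp add: emeasure_eq_measure)
  then show ?thesis
    using assms by (simp add: measure_cycle_event)
qed

lemma measure_conditioned_cycles:
  assumes A: "\<And>k. k \<le> n \<Longrightarrow> A k \<in> sets cycle_space"
  shows "measure conditioned (\<Inter>k\<le>n. path_cycle \<tau> k -` A k \<inter> space aug) =
    (\<Prod>k\<le>n. weight n k (A k) / weight n k (space cycle_space))"
proof -
  interpret prob_space "controlled \<nu>" by (rule prob_space_controlled)
  let ?D = "{\<omega> \<in> space (controlled \<nu>). \<tau> n \<omega> < \<infinity>}"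
  let ?X = "\<Inter>k\<le>n. path_cycle \<tau> k -` A k \<inter> space aug"
  have X: "?X \<in> sets (controlled \<nu>)"
    unfolding sets_controlled
    using A by (intro sets.finite_INT measurable_sets[OF measurable_path_cycle]) auto
  have "measure conditioned ?X = measure (controlled \<nu>) (?D \<inter> ?X) / measure (controlled \<nu>) ?D"
    unfolding given_started_def using pos X sets_started[of n] by (intro measure_uniform_measure) auto
  also have "?D \<inter> ?X = cycle_event n A"
    by (auto simp: cycle_event_def space_controlled)
  finally show ?thesis
    unfolding started_eq by (simp add: measure_cycle_event A prod_dividef)
qed

text \<open>The other cycles are left free, and their factors reduce to quotients of equal nonzero
  weights.\<close>

lemma measure_conditioned_cycle:
  assumes i: "i \<le> n" and B: "B \<in> sets cycle_space"
  shows "measure conditioned (path_cycle \<tau> i -` B \<inter> space aug) =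
    weight n i B / weight n i (space cycle_space)"
proof -
  let ?A = "\<lambda>k. if k = i then B else space cycle_space"
  have "path_cycle \<tau> i -` B \<inter> space aug = (\<Inter>k\<le>n. path_cycle \<tau> k -` ?A k \<inter> space aug)"
    using i path_cycle_in_space by (auto split: if_splits)
  then have "measure conditioned (path_cycle \<tau> i -` B \<inter> space aug) =
      (\<Prod>k\<le>n. weight n k (?A k) / weight n k (space cycle_space))"
    using B by (simp only:) (rule measure_conditioned_cycles, simp)
  also have "\<dots> = (\<Prod>k\<le>n. if k = i then weight n i B / weight n i (space cycle_space) else 1)"
    using weight_space_nonzero by (intro prod.cong) auto
  also have "\<dots> = weight n i B / weight n i (space cycle_space)"
    using i by simp
  finally show ?thesis .
qed

lemma sets_conditioned: "sets conditioned = sets aug"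
  by (simp add: given_started_def sets_controlled)

lemma measurable_conditioned_cycle: "path_cycle \<tau> k \<in> conditioned \<rightarrow>\<^sub>M cycle_space"
  unfolding measurable_cong_sets[OF sets_conditioned refl] by (rule measurable_path_cycle)

lemma indep_vars_conditioned:
  "prob_space.indep_vars conditioned (\<lambda>_. cycle_space) (path_cycle \<tau>) {..n}"
proof -
  interpret C: prob_space conditioned by (rule prob_space_conditioned)
  have sp: "space conditioned = space aug"
    by (rule sets_eq_imp_space_eq[OF sets_conditioned])
  let ?F = "\<lambda>k. {path_cycle \<tau> k -` A \<inter> space conditioned | A. A \<in> sets cycle_space}"
  have "C.indep_sets ?F {..n}"
  proof (subst C.indep_sets_finite)
    show "\<forall>A\<in>Pi {..n} ?F. measure conditioned (\<Inter>j\<in>{..n}. A j) = (\<Prod>j\<in>{..n}. measure conditioned (A j))"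
    proof
      fix A assume "A \<in> Pi {..n} ?F"
      then have "\<forall>k\<in>{..n}. \<exists>B. A k = path_cycle \<tau> k -` B \<inter> space conditioned \<and> B \<in> sets cycle_space"
        by (auto simp: Pi_iff)
      then obtain B where B: "\<And>k. k \<le> n \<Longrightarrow> A k = path_cycle \<tau> k -` B k \<inter> space aug"
          "\<And>k. k \<le> n \<Longrightarrow> B k \<in> sets cycle_space"
        unfolding sp by (metis atMost_iff)
      then have "(\<Inter>j\<in>{..n}. A j) = (\<Inter>k\<le>n. path_cycle \<tau> k -` B k \<inter> space aug)"
        by auto
      then have "measure conditioned (\<Inter>j\<in>{..n}. A j) =
          (\<Prod>k\<le>n. weight n k (B k) / weight n k (space cycle_space))"
        using B(2) by (simp only: measure_conditioned_cycles)
      also have "\<dots> = (\<Prod>j\<in>{..n}. measure conditioned (A j))"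
        using B measure_conditioned_cycle by (intro prod.cong) auto
      finally show "measure conditioned (\<Inter>j\<in>{..n}. A j) = (\<Prod>j\<in>{..n}. measure conditioned (A j))" .
    qed
    show "?F k \<subseteq> C.events" for k
      using measurable_sets[OF measurable_conditioned_cycle] by blast
    \<comment> \<open>With the whole space in each family, the product rule for the full index set
      contains those for all its subsets.\<close>
    show "space conditioned \<in> ?F k" for k
    proof -
      have "space conditioned = path_cycle \<tau> k -` space cycle_space \<inter> space conditioned"
        using path_cycle_in_space by (auto simp: sp)
      then show ?thesis
        by blast
    qed
  qed auto
  then show ?thesis
    using measurable_conditioned_cycle by (simp add: C.indep_vars_def2)
qed

text \<open>No lifetime restriction applies to the last cycle, so its weight is a probability
  already and the normalization is by 1. For \<open>1 \<le> n\<close> its path starts from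
  \<open>Q0\<close>, and the resulting law no longer involves \<open>n\<close>.\<close>

lemma distr_conditioned_cycle:
  assumes "1 \<le> n"
  shows "distr conditioned cycle_space (path_cycle \<tau> n) =
    distr (renewal Q0) cycle_space (first_cycle \<sigma>)"
proof (rule measure_eqI)
  fix B assume "B \<in> sets (distr conditioned cycle_space (path_cycle \<tau> n))"
  then have B: "B \<in> sets cycle_space"
    by simp
  interpret C: prob_space conditioned by (rule prob_space_conditioned)
  interpret R: prob_space "renewal Q0" by (rule prob_space_renewal)
  have sp: "space (renewal Q0) = cadlag"
    by (simp add: sets_renewal[THEN sets_eq_imp_space_eq])
  have m: "first_cycle \<sigma> \<in> renewal Q0 \<rightarrow>\<^sub>M cycle_space"
    unfolding measurable_cong_sets[OF sets_renewal(1) refl] by (rule measurable_first_cycle) (rule measurable_\<sigma>)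
  have w: "weight n n B = measure (renewal Q0) (first_cycle \<sigma> -` B \<inter> space (renewal Q0))" for B
    using assms by (auto simp: cycle_init_def cycle_paths_def sp intro!: arg_cong[where f = "measure (renewal Q0)"])
  have "first_cycle \<sigma> -` space cycle_space \<inter> space (renewal Q0) = space (renewal Q0)"
    using measurable_space[OF m] by auto
  then have "weight n n (space cycle_space) = 1"
    using R.prob_space by (simp add: w)
  then have "measure conditioned (path_cycle \<tau> n -` B \<inter> space aug) =
      measure (renewal Q0) (first_cycle \<sigma> -` B \<inter> space (renewal Q0))"
    using measure_conditioned_cycle[OF order_refl B] by (simp add: w)
  then show "emeasure (distr conditioned cycle_space (path_cycle \<tau> n)) B =
      emeasure (distr (renewal Q0) cycle_space (first_cycle \<sigma>)) B"
    using B by (simp add: emeasure_distr m measurable_conditioned_cycle C.emeasure_eq_measure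
      R.emeasure_eq_measure sets_eq_imp_space_eq[OF sets_conditioned])
qed simp

end

lemma given_started_eq:
  assumes "AE \<omega> in controlled \<nu>. \<tau> n \<omega> < \<infinity>"
  shows "given_started \<tau> n (controlled \<nu>) = controlled \<nu>"
    and "emeasure (controlled \<nu>) {\<omega> \<in> space (controlled \<nu>). \<tau> n \<omega> < \<infinity>} > 0"
proof -
  interpret prob_space "controlled \<nu>" by (rule prob_space_controlled)
  have 1: "emeasure (controlled \<nu>) {\<omega> \<in> space (controlled \<nu>). \<tau> n \<omega> < \<infinity>} = 1"
    using assms sets_started[of n] by (intro emeasure_eq_1_AE) auto
  then show "emeasure (controlled \<nu>) {\<omega> \<in> space (controlled \<nu>). \<tau> n \<omega> < \<infinity>} > 0"
    by simp
  show "given_started \<tau> n (controlled \<nu>) = controlled \<nu>"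
    unfolding given_started_def by (rule uniform_measure_almost_all[OF prob_space_axioms sets_started 1])
qed

text \<open>Independence concerns finite subfamilies, and each of them lies in some
  \<open>{..n}\<close>, where the conditional result holds with a conditioning event of probability
  one.\<close>

lemma indep_vars_controlled:
  assumes "\<And>k. AE \<omega> in controlled \<nu>. \<tau> k \<omega> < \<infinity>"
  shows "prob_space.indep_vars (controlled \<nu>) (\<lambda>_. cycle_space) (path_cycle \<tau>) UNIV"
proof -
  interpret prob_space "controlled \<nu>" by (rule prob_space_controlled)
  let ?F = "\<lambda>k. {path_cycle \<tau> k -` A \<inter> space (controlled \<nu>) | A. A \<in> sets cycle_space}"
  have "indep_vars (\<lambda>_. cycle_space) (path_cycle \<tau>) {..n}" for n
    using indep_vars_conditioned[OF given_started_eq(2)[OF assms]]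
    by (simp only: given_started_eq(1)[OF assms])
  then have n: "indep_sets ?F {..n}" for n
    by (simp add: indep_vars_def2)
  have "indep_sets ?F J" if "finite J" for J
  proof -
    have "J \<subseteq> {..Max J}"
      using that by auto
    then show ?thesis
      using n by (rule indep_sets_mono_index)
  qed
  then have "indep_sets ?F UNIV"
    by (subst indep_sets_finite_index_sets) auto
  then show ?thesis
    unfolding indep_vars_def2 by simp
qed

end

end

theorem corollary4p3:
  fixes P :: "'e::polish_space \<Rightarrow> 'e path measure"
    and ZZ :: "'z measure"
    and Q :: "'e \<times> 'z \<Rightarrow> 'e measure"
    and ebar :: 'e
    and \<tau> :: "nat \<Rightarrow> 'e apath \<Rightarrow> ennreal"
    and Z :: "nat \<Rightarrow> 'e apath \<Rightarrow> 'z"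
    and \<sigma> :: "'e path \<Rightarrow> ennreal"
    and Q0 \<nu> :: "'e measure"
  defines "PP \<equiv> ctrl_law_init P Q ebar \<tau> Z \<nu>"
  assumes "markov_family P"
    and "\<And>x. AE \<omega> in P x. continuous_on {0..} \<omega>"
    and "Q \<in> measurable (borel \<Otimes>\<^sub>M ZZ) (prob_algebra borel)"
    and "\<sigma> \<in> borel_measurable path_F"
    and "Q0 \<in> space (prob_algebra borel)"
    and "\<nu> \<in> space (prob_algebra borel)"
    and "independent_cycles_policy ZZ Q \<tau> Z (\<lambda>\<omega>. \<sigma> (snd \<omega>)) (\<lambda>_. \<sigma>) (\<lambda>_. Q0)"
  shows "PP \<in> space (prob_algebra aug)
    \<and> ((\<forall>k. AE \<omega> in PP. \<tau> k \<omega> < \<infinity>) \<longrightarrow>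
        prob_space.indep_vars PP (\<lambda>_. cycle_space) (path_cycle \<tau>) UNIV \<and>
        (\<forall>j\<ge>1. \<forall>k\<ge>1. distr PP cycle_space (path_cycle \<tau> j) = distr PP cycle_space (path_cycle \<tau> k)))
    \<and> (\<forall>n. emeasure PP {\<omega> \<in> space PP. \<tau> n \<omega> < \<infinity>} > 0 \<longrightarrow>
        prob_space.indep_vars (given_started \<tau> n PP) (\<lambda>_. cycle_space) (path_cycle \<tau>) {..n})
    \<and> (\<forall>j\<ge>1. \<forall>k\<ge>1. emeasure PP {\<omega> \<in> space PP. \<tau> j \<omega> < \<infinity>} > 0 \<longrightarrow>
        emeasure PP {\<omega> \<in> space PP. \<tau> k \<omega> < \<infinity>} > 0 \<longrightarrow>
        distr (given_started \<tau> j PP) cycle_space (path_cycle \<tau> j) =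
        distr (given_started \<tau> k PP) cycle_space (path_cycle \<tau> k))"
proof -
  interpret controlled_cycles ZZ Q \<tau> Z \<sigma> Q0 P ebar
    using assms by unfold_locales
  note \<nu> = \<open>\<nu> \<in> space (prob_algebra borel)\<close>
  have ident: "distr (given_started \<tau> j PP) cycle_space (path_cycle \<tau> j) =
      distr (given_started \<tau> k PP) cycle_space (path_cycle \<tau> k)"
    if "j \<ge> 1" "k \<ge> 1" "emeasure PP {\<omega> \<in> space PP. \<tau> j \<omega> < \<infinity>} > 0"
      "emeasure PP {\<omega> \<in> space PP. \<tau> k \<omega> < \<infinity>} > 0" for j k
    using that unfolding PP_def by (simp only: distr_conditioned_cycle[OF \<nu>])
  have "distr PP cycle_space (path_cycle \<tau> j) = distr PP cycle_space (path_cycle \<tau> k)"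
    if "\<forall>k. AE \<omega> in PP. \<tau> k \<omega> < \<infinity>" "j \<ge> 1" "k \<ge> 1" for j k
    using ident[of j k] that given_started_eq[OF \<nu>] unfolding PP_def by metis
  then show ?thesis
    using controlled_in_prob_algebra[OF \<nu>] indep_vars_controlled[OF \<nu>] indep_vars_conditioned[OF \<nu>] ident
    unfolding PP_def by blast
qed

end
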